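(* Let $m\ge2$, let $K=\mathbb{Z}\alpha_1\oplus\cdots\oplus\mathbb{Z}\alpha_m$ with $(\alpha_i,\alpha_j)=2\delta_{ij}$ (the root lattice of $A_1^{\oplus m}$), $\rho=\alpha_1+\cdots+\alpha_m$, $q=\rho/2$, and let $V=V_{K,\rho/2}=(V_K,\omega_q)$ be the shifted lattice vertex operator algebra. Let $$\mathcal K=\{u\in P_{(V_K,\omega_q)}^\circ : V_K^{(u)}\cong V_K\text{ as a }(V_K,\omega_q)\text{-module}\}.$$ Then $\mathcal K=K\cap\rho^\perp=R$, where $R=\{\sum_{i=1}^mn_i\alpha_i\in K:\sum_{i=1}^mn_i=0\}$. Moreover $\mathcal K\cong\sqrt2\,L_{A_{m-1}}$, where $L_{A_{m-1}}$ is the root lattice of the Lie algebra $A_{m-1}$. In particular the minimal norm of nonzero vectors is $\min(\mathcal K)=4$.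
   Context: $V_K$ is the lattice vertex operator algebra of the positive-definite even lattice $K$ with standard conformal vector $\omega_K$; for $q\in K^\circ$ (the dual lattice) the shifted lattice vertex operator algebra $(V_K,\omega_q)$ has the same underlying vertex algebra and conformal vector $\omega_q=\omega_K+q(-2)\mathbf 1$. Let $\mathfrak h=\mathbb{C}\otimes_{\mathbb Z}K$ with the bilinearly extended form; identify $u\in\mathfrak h$ with $u(-1)\mathbf 1$, with modes $u_n=u(n)$. Let $\mathcal M=\rho^\perp=\{u\in\mathfrak h:(u,\rho)=0\}$ (the vectors $u$ with $L_q(1)u(-1)\mathbf 1=0$, where $L_q(n)$ are the modes of $\omega_q$). $P_{(V_K,\omega_q)}\subseteq\mathcal M$ is the set of $\mathcal M$-weights: those $\beta\in\mathcal M$ for which there is $0\ne a\in V_K$ with $u_0a=(u,\beta)a$ for all $u\in\mathcal M$; $P_{(V_K,\omega_q)}^\circ=\{u\in\mathcal M:(u,\beta)\in\mathbb{Z}\text{ for all }\beta\in P_{(V_K,\omega_q)}\}$. For $u\in P_{(V_K,\omega_q)}^\circ$, $V_K^{(u)}$ is the module with underlying space $V_K$ and vertex operators $Y(\Delta(u,x)v,x)$, where $\Delta(u,x)=x^{u_0}\exp\left(\sum_{k\ge1}\frac{u_k}{-k}(-x)^{-k}\right)$. $\sqrt2L$ denotes the lattice $L$ with its form multiplied by $2$. *)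

theory Defs
  imports "HOL-Analysis.Analysis" "HOL-Library.Poly_Mapping"
    "HOL-Library.Multiset" "HOL-Library.Product_Plus"
begin

section \<open>Lattice data\<close>

text \<open>
  A lattice K of rank CARD('m) is given by a Gram matrix G with respect to a Z-basis
  (alpha_i) indexed by 'm. Elements of K are integer coordinate vectors, elements of
  h = C \<otimes> K are complex coordinate vectors.
\<close>

definition zform :: "int^'m^'m \<Rightarrow> int^'m \<Rightarrow> int^'m \<Rightarrow> int" where
  "zform G \<alpha> \<beta> = (\<Sum>i\<in>UNIV. \<Sum>j\<in>UNIV. \<alpha> $ i * G $ i $ j * \<beta> $ j)"

definition hform :: "int^'m^'m \<Rightarrow> complex^'m \<Rightarrow> complex^'m \<Rightarrow> complex" where
  "hform G u v = (\<Sum>i\<in>UNIV. \<Sum>j\<in>UNIV. u $ i * of_int (G $ i $ j) * v $ j)"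

definition lattice_embed :: "int^'m \<Rightarrow> complex^'m" where
  "lattice_embed \<alpha> = (\<chi> i. of_int (\<alpha> $ i))"

definition lattice_basis :: "'m \<Rightarrow> complex^'m" where
  "lattice_basis i = axis i 1"

text \<open>
  A normalised 2-cocycle with commutator map \<open>(\<alpha>,\<beta>) \<mapsto> (-1)^(\<alpha>,\<beta>)\<close>, as used for the twisted
  group algebra \<open>C_\<epsilon>[K]\<close>. For an even lattice such cocycles exist, and different choices
  give isomorphic vertex algebras.
\<close>

definition lattice_cocycle :: "int^'m^'m \<Rightarrow> (int^'m \<Rightarrow> int^'m \<Rightarrow> complex) \<Rightarrow> bool" where
  "lattice_cocycle G \<epsilon> \<longleftrightarrow>
     (\<forall>\<alpha> \<beta>. \<epsilon> \<alpha> \<beta> \<noteq> 0) \<and>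
     (\<forall>\<alpha>. \<epsilon> \<alpha> 0 = 1 \<and> \<epsilon> 0 \<alpha> = 1) \<and>
     (\<forall>\<alpha> \<beta> \<gamma>. \<epsilon> \<alpha> \<beta> * \<epsilon> (\<alpha> + \<beta>) \<gamma> = \<epsilon> \<beta> \<gamma> * \<epsilon> \<alpha> (\<beta> + \<gamma>)) \<and>
     (\<forall>\<alpha> \<beta>. \<epsilon> \<alpha> \<beta> = (-1) powi (zform G \<alpha> \<beta>) * \<epsilon> \<beta> \<alpha>)"


section \<open>The underlying space of the lattice vertex algebra\<close>

text \<open>
  The space \<open>S(h \<otimes> t^(-1) C[t^(-1)]) \<otimes> C_\<epsilon>[K]\<close> has as basis the pairs \<open>(M, \<beta>)\<close>, where the
  multiset M is a monomial in the \<open>\<alpha>_i(-k)\<close>, \<open>k \<ge> 1\<close>, and \<open>\<beta>\<close> stands for \<open>e^\<beta>\<close>.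
  Index shift: the letter \<open>(i, k)\<close> of M stands for \<open>\<alpha>_i(-(k+1))\<close>.
\<close>

type_synonym 'm monomial = "('m \<times> nat) multiset"
type_synonym 'm VK = "('m monomial \<times> (int^'m)) \<Rightarrow>\<^sub>0 complex"

definition vscale :: "complex \<Rightarrow> ('b \<Rightarrow>\<^sub>0 complex) \<Rightarrow> ('b \<Rightarrow>\<^sub>0 complex)" where
  "vscale c v = Poly_Mapping.map (\<lambda>x. c * x) v"

definition basis_vec :: "'b \<Rightarrow> ('b \<Rightarrow>\<^sub>0 complex)" where
  "basis_vec b = Poly_Mapping.single b 1"

definition lin_ext :: "('b \<Rightarrow> ('c \<Rightarrow>\<^sub>0 complex)) \<Rightarrow> ('b \<Rightarrow>\<^sub>0 complex) \<Rightarrow> ('c \<Rightarrow>\<^sub>0 complex)" where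
  "lin_ext f v = (\<Sum>b\<in>Poly_Mapping.keys v. vscale (Poly_Mapping.lookup v b) (f b))"

definition vacuum :: "'m::finite VK" where
  "vacuum = basis_vec ({#}, 0)"

text \<open>
  The Heisenberg operators \<open>h(n)\<close>: creation for n < 0, the scalar \<open>(h,\<beta>)\<close> on the
  \<open>\<beta>\<close>-component for n = 0, and for n > 0 the derivation with
  \<open>h(n) \<alpha>_j(-k) 1 = n (h,\<alpha>_j) \<delta>_(n,k) 1\<close>.
\<close>

definition heis :: "int^'m^'m \<Rightarrow> complex^'m \<Rightarrow> int \<Rightarrow> 'm VK \<Rightarrow> 'm VK" where
  "heis G h n = lin_ext (\<lambda>(M, \<beta>).
     if n < 0 then (\<Sum>i\<in>UNIV. vscale (h $ i) (basis_vec (add_mset (i, nat (- n) - 1) M, \<beta>)))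
     else if n = 0 then vscale (hform G h (lattice_embed \<beta>)) (basis_vec (M, \<beta>))
     else (\<Sum>j\<in>UNIV. vscale (of_int n * hform G h (lattice_basis j) * of_nat (count M (j, nat n - 1)))
                          (basis_vec (M - {#(j, nat n - 1)#}, \<beta>))))"


section \<open>Vertex operators\<close>

text \<open>
  A field is given by its modes: \<open>a n\<close> is the coefficient of \<open>z^(-n-1)\<close>.
  The sums over all j below are finite on every vector
  (\<^const>\<open>Sum_any\<close> is the sum over the finite support of a function).
\<close>

type_synonym 'm field = "int \<Rightarrow> 'm VK \<Rightarrow> 'm VK"

text \<open>\<open>(1/k!) (d/dz)^k a(z)\<close>\<close>
definition div_deriv :: "nat \<Rightarrow> 'm::finite field \<Rightarrow> 'm field" where
  "div_deriv k a = (\<lambda>n w. vscale ((-1)^k * (of_int n gchoose k)) (a (n - int k) w))"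

text \<open>
  \<open>:a(z) b(z): = a(z)\<^sup>- b(z) + b(z) a(z)\<^sup>+\<close>, where \<open>a(z)\<^sup>-\<close> consists of the modes \<open>a_n\<close>, n < 0,
  and \<open>a(z)\<^sup>+\<close> of those with \<open>n \<ge> 0\<close>.
\<close>
definition nop :: "'m::finite field \<Rightarrow> 'm field \<Rightarrow> 'm field" where
  "nop a b = (\<lambda>n w. Sum_any (\<lambda>j::nat. a (- int j - 1) (b (n + int j) w))
                 + Sum_any (\<lambda>j::nat. b (n - int j - 1) (a (int j) w)))"

text \<open>
  \<open>ser_pow A r n\<close> and \<open>ser_exp A n\<close> are the coefficients of \<open>x^n\<close> in \<open>(\<Sum>k\<ge>1. A k x^k)^r\<close> and
  \<open>exp(\<Sum>k\<ge>1. A k x^k)\<close>.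
\<close>
fun ser_pow :: "(nat \<Rightarrow> ('b \<Rightarrow>\<^sub>0 complex) \<Rightarrow> ('b \<Rightarrow>\<^sub>0 complex)) \<Rightarrow> nat \<Rightarrow> nat
    \<Rightarrow> ('b \<Rightarrow>\<^sub>0 complex) \<Rightarrow> ('b \<Rightarrow>\<^sub>0 complex)" where
  "ser_pow A 0 n v = (if n = 0 then v else 0)"
| "ser_pow A (Suc r) n v = (\<Sum>k=1..n. A k (ser_pow A r (n - k) v))"

definition ser_exp :: "(nat \<Rightarrow> ('b \<Rightarrow>\<^sub>0 complex) \<Rightarrow> ('b \<Rightarrow>\<^sub>0 complex)) \<Rightarrow> nat
    \<Rightarrow> ('b \<Rightarrow>\<^sub>0 complex) \<Rightarrow> ('b \<Rightarrow>\<^sub>0 complex)" where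
  "ser_exp A n v = (\<Sum>r\<le>n. vscale (1 / fact r) (ser_pow A r n v))"

text \<open>
  \<open>Y(e^\<alpha>, z) = exp(\<Sum>k\<ge>1. \<alpha>(-k)/k z^k) exp(\<Sum>k\<ge>1. -\<alpha>(k)/k z^(-k)) e_\<alpha> z^(\<alpha>(0))\<close> with
  \<open>e_\<alpha> e^\<beta> = \<epsilon>(\<alpha>,\<beta>) e^(\<alpha>+\<beta>)\<close>. In the mode n, i.e. the coefficient of \<open>z^(-n-1)\<close>, the second
  exponential contributes \<open>z^(-b)\<close> and the first one \<open>z^a\<close> with \<open>a - b + (\<alpha>,\<beta>) = -n-1\<close>, \<open>a \<ge> 0\<close>.
\<close>
definition exp_field :: "int^'m^'m \<Rightarrow> (int^'m \<Rightarrow> int^'m \<Rightarrow> complex) \<Rightarrow> int^'m \<Rightarrow> 'm field" where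
  "exp_field G \<epsilon> \<alpha> n = lin_ext (\<lambda>(M, \<beta>).
     vscale (\<epsilon> \<alpha> \<beta>) (Sum_any (\<lambda>b::nat.
       let a = int b - zform G \<alpha> \<beta> - n - 1 in
       if a < 0 then 0
       else ser_exp (\<lambda>k v. vscale (1 / of_nat k) (heis G (lattice_embed \<alpha>) (- int k) v)) (nat a)
             (ser_exp (\<lambda>k v. vscale (- 1 / of_nat k) (heis G (lattice_embed \<alpha>) (int k) v)) b
               (basis_vec (M, \<alpha> + \<beta>))))))"

text \<open>
  \<open>Y(\<alpha>_(i\<^sub>1)(-k\<^sub>1-1) ... \<alpha>_(i\<^sub>r)(-k\<^sub>r-1) e^\<alpha>, z)
     = :\<partial>^(k\<^sub>1)\<alpha>_(i\<^sub>1)(z)/k\<^sub>1! ... \<partial>^(k\<^sub>r)\<alpha>_(i\<^sub>r)(z)/k\<^sub>r! Y(e^\<alpha>, z):\<close>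
\<close>
fun word_field :: "int^'m^'m \<Rightarrow> (int^'m \<Rightarrow> int^'m \<Rightarrow> complex) \<Rightarrow> ('m \<times> nat) list \<Rightarrow> int^'m
    \<Rightarrow> 'm::finite field" where
  "word_field G \<epsilon> [] \<alpha> = exp_field G \<epsilon> \<alpha>"
| "word_field G \<epsilon> ((i, k) # ws) \<alpha> =
     nop (div_deriv k (heis G (lattice_basis i))) (word_field G \<epsilon> ws \<alpha>)"

text \<open>
  The Heisenberg fields commute under the normal ordering, so the choice of a word
  for the monomial M does not matter.
\<close>
definition word_of :: "'m monomial \<Rightarrow> ('m \<times> nat) list" where
  "word_of M = (SOME ws. mset ws = M)"

text \<open>\<open>vertex_op G \<epsilon> v n w\<close> is \<open>v_n w\<close>, the coefficient of \<open>z^(-n-1)\<close> in \<open>Y(v, z) w\<close>.\<close>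
definition vertex_op :: "int^'m^'m \<Rightarrow> (int^'m \<Rightarrow> int^'m \<Rightarrow> complex) \<Rightarrow> 'm VK \<Rightarrow> int \<Rightarrow> 'm VK \<Rightarrow> 'm VK"
  where "vertex_op G \<epsilon> v n w = lin_ext (\<lambda>(M, \<alpha>). word_field G \<epsilon> (word_of M) \<alpha> n w) v"


section \<open>Shifted lattice vertex operator algebras\<close>

record 'm voa =
  vac :: "'m VK"
  vop :: "'m VK \<Rightarrow> int \<Rightarrow> 'm VK \<Rightarrow> 'm VK"
  conf :: "'m VK"

text \<open>The identification of \<open>u \<in> h\<close> with \<open>u(-1)1\<close>.\<close>
definition hstate :: "int^'m^'m \<Rightarrow> complex^'m \<Rightarrow> 'm VK" where
  "hstate G u = heis G u (-1) vacuum"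

text \<open>
  \<open>\<omega>_K = 1/2 \<Sum>_i \<alpha>_i(-1) \<alpha>^i(-1) 1\<close>, with \<open>(\<alpha>^i)\<close> the basis of h dual to \<open>(\<alpha>_i)\<close>, whose
  coordinates are the rows of the inverse Gram matrix.
\<close>
definition omega_std :: "int^'m^'m \<Rightarrow> 'm VK" where
  "omega_std G = (let H = matrix_inv ((\<chi> i j. of_int (G $ i $ j)) :: complex^'m^'m) in
     vscale (1/2) (\<Sum>i\<in>UNIV. heis G (lattice_basis i) (-1) (heis G (H $ i) (-1) vacuum)))"

definition omega_shift :: "int^'m^'m \<Rightarrow> complex^'m \<Rightarrow> 'm VK" where
  "omega_shift G q = omega_std G + heis G q (-2) vacuum"

definition shifted_lattice_voa ::
    "int^'m^'m \<Rightarrow> (int^'m \<Rightarrow> int^'m \<Rightarrow> complex) \<Rightarrow> complex^'m \<Rightarrow> 'm::finite voa" where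
  "shifted_lattice_voa G \<epsilon> q = \<lparr> vac = vacuum, vop = vertex_op G \<epsilon>, conf = omega_shift G q \<rparr>"

definition virasoro :: "'m::finite voa \<Rightarrow> int \<Rightarrow> 'm VK \<Rightarrow> 'm VK" where
  "virasoro V n = vop V (conf V) (n + 1)"

text \<open>
  The space of those \<open>u \<in> h\<close> with \<open>L(1) u(-1)1 = 0\<close>; for the conformal vector \<open>\<omega>_q\<close> it is the
  orthogonal complement of q, see lemma \<open>M_space_shifted_lattice_voa\<close>.
\<close>
definition M_space :: "int^'m^'m \<Rightarrow> 'm voa \<Rightarrow> (complex^'m) set" where
  "M_space G V = {u. virasoro V 1 (hstate G u) = 0}"

definition weights :: "int^'m^'m \<Rightarrow> 'm voa \<Rightarrow> (complex^'m) set" where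
  "weights G V = {\<beta> \<in> M_space G V. \<exists>a. a \<noteq> 0 \<and>
      (\<forall>u\<in>M_space G V. heis G u 0 a = vscale (hform G u \<beta>) a)}"

definition weights_dual :: "int^'m^'m \<Rightarrow> 'm voa \<Rightarrow> (complex^'m) set" where
  "weights_dual G V = {u \<in> M_space G V. \<forall>\<beta>\<in>weights G V. hform G u \<beta> \<in> \<int>}"


section \<open>Modules twisted by \<open>\<Delta>(u,x)\<close>\<close>

text \<open>
  The coefficient of \<open>x^t\<close> in \<open>x^(u_0)\<close>, i.e. the projection onto the t-eigenspace of
  \<open>u_0\<close>, which acts on the \<open>\<beta>\<close>-component as \<open>(u,\<beta>)\<close>.
\<close>
definition xpow :: "int^'m^'m \<Rightarrow> complex^'m \<Rightarrow> int \<Rightarrow> 'm VK \<Rightarrow> 'm VK" where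
  "xpow G u t = lin_ext (\<lambda>(M, \<beta>).
     if hform G u (lattice_embed \<beta>) = of_int t then basis_vec (M, \<beta>) else 0)"

text \<open>
  The coefficient of \<open>x^s\<close> in \<open>\<Delta>(u,x) = x^(u_0) exp(\<Sum>k\<ge>1. u_k/(-k) (-x)^(-k))\<close>; the exponent
  is a series in \<open>x^(-1)\<close>, in which \<open>x^(-k)\<close> has the coefficient \<open>(-1)^k/(-k) u_k\<close>.
\<close>
definition Delta :: "int^'m^'m \<Rightarrow> complex^'m \<Rightarrow> int \<Rightarrow> 'm VK \<Rightarrow> 'm VK" where
  "Delta G u s v = Sum_any (\<lambda>n::nat. xpow G u (s + int n)
     (ser_exp (\<lambda>k w. vscale ((-1)^k / (- of_nat k)) (heis G u (int k) w)) n v))"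

text \<open>
  The coefficient of \<open>x^(-l-1)\<close> in \<open>Y(\<Delta>(u,x)v, x)w = (\<Sum>s n. (\<Delta>_s v)_n w x^(s-n-1))\<close>.
\<close>
definition twisted_op :: "int^'m^'m \<Rightarrow> 'm voa \<Rightarrow> complex^'m \<Rightarrow> 'm VK \<Rightarrow> int \<Rightarrow> 'm VK \<Rightarrow> 'm VK" where
  "twisted_op G V u v l w = Sum_any (\<lambda>s::int. vop V (Delta G u s v) (l + s) w)"

text \<open>
  Isomorphism of two V-modules given by their modes \<open>A v n\<close> and \<open>B v n\<close>, v in V.
\<close>
definition module_iso ::
    "('v \<Rightarrow> int \<Rightarrow> ('b \<Rightarrow>\<^sub>0 complex) \<Rightarrow> ('b \<Rightarrow>\<^sub>0 complex)) \<Rightarrow>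
     ('v \<Rightarrow> int \<Rightarrow> ('c \<Rightarrow>\<^sub>0 complex) \<Rightarrow> ('c \<Rightarrow>\<^sub>0 complex)) \<Rightarrow> bool" where
  "module_iso A B \<longleftrightarrow> (\<exists>f. bij f \<and>
     (\<forall>w w'. f (w + w') = f w + f w') \<and>
     (\<forall>c w. f (vscale c w) = vscale c (f w)) \<and>
     (\<forall>v n w. f (A v n w) = B v n (f w)))"


section \<open>Lattices\<close>

text \<open>For finite S.\<close>
definition zspan :: "'a::real_vector set \<Rightarrow> 'a set" where
  "zspan S = {\<Sum>v\<in>S. real_of_int (c v) *\<^sub>R v |c. True}"

text \<open>
  The root system \<open>{\<epsilon>_i - \<epsilon>_j | i \<noteq> j}\<close> of type \<open>A_(m-1)\<close> with m = CARD('m), and its root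
  lattice, with the standard inner product (roots have norm 2).
\<close>
definition A_roots :: "(real^'m) set" where
  "A_roots = {axis i 1 - axis j 1 |i j. i \<noteq> j}"

definition A_root_lattice :: "(real^'m) set" where
  "A_root_lattice = zspan A_roots"

definition lattice_isometric ::
    "'a::ab_group_add set \<Rightarrow> ('a \<Rightarrow> 'a \<Rightarrow> complex) \<Rightarrow> 'b::ab_group_add set \<Rightarrow> ('b \<Rightarrow> 'b \<Rightarrow> complex) \<Rightarrow> bool"
  where
  "lattice_isometric S bS T bT \<longleftrightarrow> (\<exists>f. bij_betw f S T \<and>
     (\<forall>x\<in>S. \<forall>y\<in>S. f (x + y) = f x + f y) \<and>
     (\<forall>x\<in>S. \<forall>y\<in>S. bT (f x) (f y) = bS x y))"

definition is_min_norm :: "('a::zero \<Rightarrow> 'a \<Rightarrow> complex) \<Rightarrow> 'a set \<Rightarrow> real \<Rightarrow> bool" where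
  "is_min_norm b S c \<longleftrightarrow>
     (\<exists>v\<in>S. v \<noteq> 0 \<and> b v v = of_real c) \<and>
     (\<forall>v\<in>S. v \<noteq> 0 \<longrightarrow> (\<exists>r\<ge>c. b v v = of_real r))"


section \<open>Vertex operators of the vacuum and of h, and the space M\<close>

lemma lookup_vscale [simp]:
  "Poly_Mapping.lookup (vscale c v) b = c * Poly_Mapping.lookup v b"
  by (simp add: vscale_def map.rep_eq when_def)

lemma vscale_simps [simp]:
  "vscale 0 v = 0" "vscale 1 v = v" "vscale c 0 = 0"
  "vscale c (vscale d v) = vscale (c * d) v"
  "vscale c (v + w) = vscale c v + vscale c w"
  by (rule poly_mapping_eqI; simp add: lookup_add algebra_simps)+

lemma vscale_add_left: "vscale (c + d) v = vscale c v + vscale d v"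
  by (rule poly_mapping_eqI) (simp add: lookup_add algebra_simps)

lemma vscale_sum: "vscale c (sum f S) = (\<Sum>i\<in>S. vscale c (f i))"
  by (induction S rule: infinite_finite_induct) simp_all

lemma vscale_sum_left: "vscale (sum f S) v = (\<Sum>i\<in>S. vscale (f i) v)"
  by (induction S rule: infinite_finite_induct) (simp_all add: vscale_add_left)

lemma lin_ext_superset:
  assumes "finite S" "Poly_Mapping.keys v \<subseteq> S"
  shows "lin_ext f v = (\<Sum>b\<in>S. vscale (Poly_Mapping.lookup v b) (f b))"
  unfolding lin_ext_def using assms
  by (intro sum.mono_neutral_left) (auto simp: in_keys_iff)

lemma lin_ext_basis [simp]: "lin_ext f (basis_vec b) = f b"
  by (simp add: lin_ext_def basis_vec_def)

lemma lin_ext_zero [simp]: "lin_ext f 0 = 0"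
  by (simp add: lin_ext_def)

lemma lin_ext_add: "lin_ext f (v + w) = lin_ext f v + lin_ext f w"
proof -
  let ?S = "Poly_Mapping.keys v \<union> Poly_Mapping.keys w"
  have "Poly_Mapping.keys (v + w) \<subseteq> ?S" by (rule keys_add)
  then show ?thesis
    by (simp add: lin_ext_superset[of ?S] lookup_add vscale_add_left sum.distrib)
qed

lemma lin_ext_vscale: "lin_ext f (vscale c v) = vscale c (lin_ext f v)"
proof -
  have "Poly_Mapping.keys (vscale c v) \<subseteq> Poly_Mapping.keys v"
    by (auto simp: in_keys_iff)
  then show ?thesis
    by (simp add: lin_ext_superset[of "Poly_Mapping.keys v"] vscale_sum)
qed

lemma lin_ext_sum: "lin_ext f (sum g S) = (\<Sum>i\<in>S. lin_ext f (g i))"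
  by (induction S rule: infinite_finite_induct) (simp_all add: lin_ext_add)

lemma lin_ext_id: "lin_ext basis_vec v = v"
proof (rule poly_mapping_eqI)
  fix b show "Poly_Mapping.lookup (lin_ext basis_vec v) b = Poly_Mapping.lookup v b"
    by (auto simp: lin_ext_def lookup_sum basis_vec_def lookup_single when_def in_keys_iff
        if_distrib[of "\<lambda>x. _ * x"] sum.delta cong: if_cong)
qed

lemma lin_ext_eqI: "(\<And>b. f b = g b) \<Longrightarrow> lin_ext f v = lin_ext g v"
  by (simp add: lin_ext_def)

lemma Sum_any_single:
  assumes "\<And>j. j \<noteq> a \<Longrightarrow> f j = 0" shows "Sum_any f = f a"
  using Sum_any.expand_superset[of "{a}" f] assms by auto

lemma hform_lincomb_left:
  "(\<Sum>i\<in>UNIV. u $ i * hform G (lattice_basis i) v) = hform G u v"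
proof -
  have "hform G (lattice_basis i) v = (\<Sum>j\<in>UNIV. of_int (G $ i $ j) * v $ j)" for i
  proof -
    have "hform G (lattice_basis i) v =
        (\<Sum>k\<in>UNIV. if k = i then (\<Sum>j\<in>UNIV. of_int (G $ k $ j) * v $ j) else 0)"
      unfolding hform_def by (rule sum.cong) (simp_all add: lattice_basis_def axis_def)
    then show ?thesis by simp
  qed
  then show ?thesis by (simp add: hform_def sum_distrib_left mult.assoc)
qed

lemma lattice_embed_zero [simp]: "lattice_embed 0 = 0"
  by (simp add: lattice_embed_def vec_eq_iff)

lemma hform_zero [simp]: "hform G 0 v = 0" "hform G u 0 = 0"
  by (simp_all add: hform_def)

lemma heis_zero [simp]: "heis G h n 0 = 0"
  by (simp add: heis_def)

text \<open>The component \<open>e^0\<close> yields the identity field.\<close>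

lemma ser_pow_trivial:
  assumes "\<And>k v. A k v = 0" shows "ser_exp A n v = (if n = 0 then v else 0)"
proof -
  have "ser_pow A r n v = (if r = 0 \<and> n = 0 then v else 0)" for r
    by (cases r) (simp_all add: assms)
  then show ?thesis
    by (auto simp: ser_exp_def if_distrib[of "vscale _"] intro!: sum.neutral cong: if_cong)
qed

lemma heis_zero_left [simp]: "heis G 0 n v = 0"
proof -
  have "heis G 0 n v = lin_ext (\<lambda>_. 0) v"
    unfolding heis_def by (rule lin_ext_eqI) (auto split: prod.splits)
  then show ?thesis by (simp add: lin_ext_def)
qed

lemma exp_field_zero:
  assumes "lattice_cocycle G \<epsilon>"
  shows "exp_field G \<epsilon> 0 n w = (if n = -1 then w else 0)"
proof -
  have z: "zform G 0 \<beta> = 0" for \<beta> by (simp add: zform_def)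
  have e: "\<epsilon> 0 \<beta> = 1" for \<beta> using assms unfolding lattice_cocycle_def by blast
  have *: "Sum_any (\<lambda>b::nat. let a = int b - 0 - n - 1 in
       if a < 0 then 0
       else ser_exp (\<lambda>k v. vscale (1 / of_nat k) (heis G (lattice_embed 0) (- int k) v)) (nat a)
             (ser_exp (\<lambda>k v. vscale (- 1 / of_nat k) (heis G (lattice_embed 0) (int k) v)) b
               (basis_vec x))) = (if n = -1 then basis_vec x else 0)" for x
    by (subst Sum_any_single[of 0]) (auto simp: ser_pow_trivial Let_def)
  have "exp_field G \<epsilon> 0 n w = lin_ext (\<lambda>b. if n = -1 then basis_vec b else 0) w"
    unfolding exp_field_def
    by (rule lin_ext_eqI) (simp only: split_paired_all prod.case z e * add_0 vscale_simps)
  also have "\<dots> = (if n = -1 then w else 0)"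
    using lin_ext_id[of w] by (simp add: lin_ext_def)
  finally show ?thesis .
qed

lemma nop_identity:
  assumes "\<And>n. a n 0 = 0" and "\<And>n w. b n w = (if n = -1 then w else 0)"
  shows "nop a b = a"
proof (intro ext)
  fix n w
  have 1: "Sum_any (\<lambda>j::nat. a (- int j - 1) (b (n + int j) w)) = (if n < 0 then a n w else 0)"
    by (subst Sum_any_single[of "nat (-n-1)"]) (auto simp: assms)
  have 2: "Sum_any (\<lambda>j::nat. b (n - int j - 1) (a (int j) w)) = (if n < 0 then 0 else a n w)"
    by (subst Sum_any_single[of "nat n"]) (auto simp: assms)
  show "nop a b n w = a n w" by (simp add: nop_def 1 2)
qed

lemma div_deriv_zero [simp]: "div_deriv 0 a = a"
  by (simp add: div_deriv_def)

lemma word_field_single: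
  assumes "lattice_cocycle G \<epsilon>"
  shows "word_field G \<epsilon> [(i, k)] 0 = div_deriv k (heis G (lattice_basis i))"
  by (simp, rule nop_identity) (simp_all add: exp_field_zero[OF assms] div_deriv_def)

lemma word_of_mset: "mset (word_of M) = M"
  unfolding word_of_def using ex_mset[of M] by (rule someI_ex)

lemma word_of_single [simp]: "word_of {#a#} = [a]"
  using word_of_mset[of "{#a#}"] by (simp)

lemma word_of_pair: "word_of {#a, b#} = [a, b] \<or> word_of {#a, b#} = [b, a]"
proof -
  have "mset (word_of {#a, b#}) = {#a, b#}" by (rule word_of_mset)
  moreover from this have "length (word_of {#a, b#}) = 2"
    by (metis size_mset size_add_mset size_empty One_nat_def Suc_1)
  then obtain x y where "word_of {#a, b#} = [x, y]"
    by (auto simp: numeral_2_eq_2 length_Suc_conv)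
  ultimately show ?thesis by (auto simp: add_eq_conv_ex)
qed

lemma heis_lincomb: "heis G h n w = (\<Sum>i\<in>UNIV. vscale (h $ i) (heis G (lattice_basis i) n w))"
proof -
  have b: "lattice_basis i $ j = (if j = i then 1 else 0)" for i j :: 'a
    by (auto simp: lattice_basis_def axis_def)
  let ?F = "\<lambda>h (M, \<beta>).
     if n < 0 then (\<Sum>i\<in>UNIV. vscale (h $ i) (basis_vec (add_mset (i, nat (- n) - 1) M, \<beta>)))
     else if n = 0 then vscale (hform G h (lattice_embed \<beta>)) (basis_vec (M, \<beta>))
     else (\<Sum>j\<in>UNIV. vscale (of_int n * hform G h (lattice_basis j) * of_nat (count M (j, nat n - 1)))
                          (basis_vec (M - {#(j, nat n - 1)#}, \<beta>)))"
  have "?F h x = (\<Sum>i\<in>UNIV. vscale (h $ i) (?F (lattice_basis i) x))" for x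
  proof (cases x)
    case (Pair M \<beta>)
    consider "n < 0" | "n = 0" | "n > 0" by linarith
    then show ?thesis
    proof cases
      case 1
      have "(\<Sum>j\<in>UNIV. vscale (lattice_basis i $ j) (f j)) = f i" for i and f :: "'a \<Rightarrow> 'a VK"
      proof -
        have "(\<Sum>j\<in>UNIV. vscale (lattice_basis i $ j) (f j)) = (\<Sum>j\<in>UNIV. if j = i then f j else 0)"
          by (intro sum.cong) (auto simp: b)
        then show ?thesis by simp
      qed
      then show ?thesis using 1 Pair by simp
    next
      case 2
      then show ?thesis using Pair
        by (simp add: vscale_sum_left[symmetric] hform_lincomb_left)
    next
      case 3
      have "(\<Sum>i\<in>UNIV. h $ i * (of_int n * hform G (lattice_basis i) v * c))
          = of_int n * hform G h v * c" for v c
        unfolding hform_lincomb_left[of h G v, symmetric]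
        by (simp add: sum_distrib_left sum_distrib_right algebra_simps)
      then show ?thesis using Pair 3
        by (simp add: vscale_sum, subst sum.swap)
           (simp add: vscale_sum_left[symmetric])
    qed
  qed
  then have "lin_ext (?F h) w = lin_ext (\<lambda>x. \<Sum>i\<in>UNIV. vscale (h $ i) (?F (lattice_basis i) x)) w"
    by (rule lin_ext_eqI)
  also have "\<dots> = (\<Sum>i\<in>UNIV. vscale (h $ i) (lin_ext (?F (lattice_basis i)) w))"
    unfolding lin_ext_def
    by (simp add: vscale_sum mult.commute) (rule sum.swap)
  finally show ?thesis unfolding heis_def .
qed

lemma heis_neg_vacuum:
  "heis G h (- int (Suc k)) vacuum = (\<Sum>i\<in>UNIV. vscale (h $ i) (basis_vec ({#(i, k)#}, 0)))"
proof -
  have "nat (- (- int (Suc k))) - 1 = k" by simp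
  then show ?thesis
    unfolding heis_def vacuum_def lin_ext_basis by (simp only: prod.case) simp
qed

text \<open>\<open>Y(h(-k-1)1, z) = 1/k! (d/dz)^k h(z)\<close>; in particular \<open>Y(u(-1)1, z)\<close> has the modes \<open>u(n)\<close>.\<close>

lemma vertex_op_heis:
  assumes "lattice_cocycle G \<epsilon>"
  shows "vertex_op G \<epsilon> (heis G h (- int (Suc k)) vacuum) n w = div_deriv k (heis G h) n w"
proof -
  have "vertex_op G \<epsilon> (heis G h (- int (Suc k)) vacuum) n w =
      (\<Sum>i\<in>UNIV. vscale (h $ i) (div_deriv k (heis G (lattice_basis i)) n w))"
    unfolding heis_neg_vacuum
    by (simp add: vertex_op_def lin_ext_sum lin_ext_vscale word_field_single[OF assms] del: word_field.simps)
  also have "\<dots> = div_deriv k (heis G h) n w"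
    unfolding div_deriv_def heis_lincomb[of G h]
    by (simp add: vscale_sum mult.commute)
  finally show ?thesis .
qed

lemma vertex_op_hstate:
  assumes "lattice_cocycle G \<epsilon>"
  shows "vertex_op G \<epsilon> (hstate G u) n w = heis G u n w"
  using vertex_op_heis[OF assms, of u 0] by (simp add: hstate_def)

lemma vertex_op_vacuum:
  assumes "lattice_cocycle G \<epsilon>"
  shows "vertex_op G \<epsilon> vacuum n w = (if n = -1 then w else 0)"
proof -
  have "word_of ({#} :: 'a monomial) = []" using word_of_mset[of "{#} :: 'a monomial"] by simp
  then show ?thesis by (simp add: vertex_op_def vacuum_def exp_field_zero[OF assms])
qed

lemma heis_nonneg_hstate:
  assumes "\<And>i j. G $ i $ j = G $ j $ i" "n \<ge> 0"
  shows "heis G h n (hstate G u) = (if n = 1 then vscale (hform G h u) vacuum else 0)"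
proof -
  have sym: "hform G u v = hform G v u" for u v
    unfolding hform_def
    by (subst sum.swap) (simp add: assms(1) mult.commute mult.left_commute)
  have lin: "(\<Sum>i\<in>UNIV. u $ i * hform G h (lattice_basis i)) = hform G h u"
    using hform_lincomb_left[of u G h] by (simp add: sym)
  have hs: "hstate G u = (\<Sum>i\<in>UNIV. vscale (u $ i) (basis_vec ({#(i, 0)#}, 0)))"
    using heis_neg_vacuum[of G u 0] by (simp add: hstate_def)
  have key: "heis G h n (basis_vec ({#(i, 0)#}, 0)) =
      (if n = 1 then vscale (hform G h (lattice_basis i)) vacuum else 0)" for i
  proof (cases "n = 0")
    case True then show ?thesis by (simp add: heis_def)
  next
    case False
    with assms(2) have n: "n > 0" by simp
    have "heis G h n (basis_vec ({#(i, 0)#}, 0)) = (\<Sum>j\<in>UNIV. if j = i then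
        (if n = 1 then vscale (hform G h (lattice_basis i)) vacuum else 0) else 0)"
    proof -
      have "nat n - 1 = 0 \<longleftrightarrow> n = 1" using n by linarith
      moreover have "\<not> n < 0" "n \<noteq> 0" using n by simp_all
      ultimately show ?thesis
        unfolding heis_def lin_ext_basis prod.case
        by (simp only: if_False, intro sum.cong) (auto simp: vacuum_def)
    qed
    then show ?thesis by simp
  qed
  have "heis G h n (hstate G u) = (\<Sum>i\<in>UNIV. vscale (u $ i) (heis G h n (basis_vec ({#(i, 0)#}, 0))))"
    unfolding hs heis_def by (simp add: lin_ext_sum lin_ext_vscale)
  then show ?thesis
    by (simp add: key vscale_sum_left[symmetric] lin)
qed

lemma heis_zero_vacuum [simp]: "heis G h 0 vacuum = 0"
  by (simp add: heis_def vacuum_def)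

lemma omega_std_L1:
  assumes "lattice_cocycle G \<epsilon>" "\<And>i j. G $ i $ j = G $ j $ i"
  shows "vertex_op G \<epsilon> (omega_std G) 2 (hstate G u) = 0"
proof -
  have nop0: "nop (heis G g) (heis G h) 2 (hstate G u) = 0" for g h
  proof -
    have 1: "(\<lambda>j::nat. heis G g (- int j - 1) (heis G h (2 + int j) (hstate G u))) = (\<lambda>_. 0)"
      by (simp add: fun_eq_iff heis_nonneg_hstate[OF assms(2)])
    have 2: "heis G h (2 - int j - 1) (heis G g (int j) (hstate G u)) = 0" for j
      by (cases "j = 1") (simp_all add: heis_nonneg_hstate[OF assms(2)] 
          vscale_simps(1) heis_def[of G h "0::int"] lin_ext_vscale vacuum_def)
    then have 2: "(\<lambda>j::nat. heis G h (2 - int j - 1) (heis G g (int j) (hstate G u))) = (\<lambda>_. 0)"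
      by blast
    show ?thesis unfolding nop_def 1 2 by simp
  qed
  have pair: "word_field G \<epsilon> [(i, 0), (j, 0)] 0 2 (hstate G u) = 0" for i j
    using word_field_single[OF assms(1), of j 0] nop0 by simp
  have pair': "word_field G \<epsilon> (word_of {#(i, 0), (j, 0)#}) 0 2 (hstate G u) = 0" for i j
    using word_of_pair[of "(i,0)" "(j,0)"] pair[of i j] pair[of j i] by metis
  have *: "vertex_op G \<epsilon> (heis G (lattice_basis i) (-1) (heis G h (-1) vacuum)) 2 (hstate G u) = 0" for i h
  proof -
    have "heis G (lattice_basis i) (-1) (heis G h (-1) vacuum)
        = (\<Sum>j\<in>UNIV. vscale (h $ j) (\<Sum>k\<in>UNIV. vscale (lattice_basis i $ k) (basis_vec ({#(k,0),(j,0)#}, 0))))"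
      using heis_neg_vacuum[of G h 0]
      by (simp add: heis_def lin_ext_sum lin_ext_vscale)
    then show ?thesis
      by (simp add: vertex_op_def lin_ext_sum lin_ext_vscale pair' del: word_field.simps)
  qed
  show ?thesis
    using * by (simp add: omega_std_def Let_def vertex_op_def lin_ext_sum lin_ext_vscale)
qed

lemma vacuum_nonzero: "vacuum \<noteq> 0"
  by (metis vacuum_def basis_vec_def lookup_single_eq lookup_zero zero_neq_one)

lemma M_space_shifted_lattice_voa:
  assumes "lattice_cocycle G \<epsilon>" "\<And>i j. G $ i $ j = G $ j $ i"
  shows "M_space G (shifted_lattice_voa G \<epsilon> q) = {u. hform G u q = 0}"
proof -
  have sym: "hform G u v = hform G v u" for u v
    unfolding hform_def
    by (subst sum.swap) (simp add: assms(2) mult.commute mult.left_commute)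
  have "virasoro (shifted_lattice_voa G \<epsilon> q) 1 (hstate G u) = vscale (- 2 * hform G u q) vacuum" for u
  proof -
    have "virasoro (shifted_lattice_voa G \<epsilon> q) 1 (hstate G u) =
       vertex_op G \<epsilon> (omega_std G) 2 (hstate G u) +
       vertex_op G \<epsilon> (heis G q (- int (Suc 1)) vacuum) 2 (hstate G u)"
      by (simp add: virasoro_def shifted_lattice_voa_def omega_shift_def vertex_op_def lin_ext_add)
    also have "\<dots> = vscale (- 2 * hform G u q) vacuum"
      unfolding omega_std_L1[OF assms] vertex_op_heis[OF assms(1)]
      by (simp add: div_deriv_def heis_nonneg_hstate[OF assms(2)] sym[of q])
    finally show ?thesis .
  qed
  moreover have "vscale c vacuum = (0 :: 'a VK) \<longleftrightarrow> c = 0" for c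
  proof
    assume "vscale c vacuum = (0 :: 'a VK)"
    then have "Poly_Mapping.lookup (vscale c vacuum :: 'a VK) ({#}, 0) = 0" by simp
    then show "c = 0" by (simp add: vacuum_def basis_vec_def)
  qed simp
  ultimately show ?thesis by (simp add: M_space_def)
qed

end

theory Submission
  imports Defs
begin

text \<open>
  For \<open>u = \<gamma>\<close> in K the map \<open>h \<otimes> e^\<beta> \<mapsto> \<epsilon>(\<beta>,\<gamma>) h \<otimes> e^(\<beta>+\<gamma>)\<close> intertwines \<open>\<alpha>_i(z)\<close> with
  \<open>\<alpha>_i(z) + (\<gamma>,\<alpha>_i) z^(-1)\<close> and \<open>Y(e^\<alpha>,z)\<close> with \<open>z^((\<gamma>,\<alpha>)) Y(e^\<alpha>,z)\<close>. Since \<open>\<Delta>(u,x)\<close> substitutes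
  \<open>\<alpha>_i(-k) + (-1)^(k+1) (u,\<alpha>_i) x^(-k)\<close> for \<open>\<alpha>_i(-k)\<close> and multiplies \<open>e^\<alpha>\<close> by \<open>x^((u,\<alpha>))\<close>, normal
  ordering turns this into an isomorphism from the twisted module onto \<open>V_K\<close>. Conversely, the image of the
  vacuum under an isomorphism has \<open>\<alpha>_i(0)\<close>-eigenvalue \<open>(u,\<alpha>_i)\<close>, which forces u into K.
\<close>

section \<open>Linear maps and locally finite sums\<close>

text \<open>\<open>module_iso\<close> asks for compatibility with each mode of each v, and both
  sides are linear in v; so the intertwining relation is checked on monomials, by induction on a
  word, one Heisenberg letter at a time. Two obstacles shape the preparation. \<open>Sum_any\<close>
  is 0 on infinite supports, so linearity and the interchange of sums hinge on truncation. And
  \<open>vertex_op\<close> reads a monomial through an arbitrarily chosen word, so a letter can be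
  split off only once nested normally ordered products are known to commute. In the converse
  direction, membership in the dual of the weights is weaker than membership in K: for m = 2 the
  vector (alpha_1 - alpha_2)/2 lies in that dual but not in K. What pins u down is the pairing with
  all alpha_i, including directions outside M.\<close>

definition vlin :: "(('b \<Rightarrow>\<^sub>0 complex) \<Rightarrow> ('c \<Rightarrow>\<^sub>0 complex)) \<Rightarrow> bool" where
  "vlin F \<longleftrightarrow> (\<forall>v w. F (v + w) = F v + F w) \<and> (\<forall>c v. F (vscale c v) = vscale c (F v))"

lemma vlinI:
  assumes "\<And>v w. F (v + w) = F v + F w" "\<And>c v. F (vscale c v) = vscale c (F v)"
  shows "vlin F"
  using assms by (simp add: vlin_def)

lemma vlin_add: "vlin F \<Longrightarrow> F (v + w) = F v + F w"
  and vlin_vscale: "vlin F \<Longrightarrow> F (vscale c v) = vscale c (F v)"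
  by (simp_all add: vlin_def)

lemma vlin_zero: "vlin F \<Longrightarrow> F 0 = 0"
  using vlin_vscale[of F 0 0] by simp

lemma vlin_sum: "vlin F \<Longrightarrow> F (sum g S) = (\<Sum>i\<in>S. F (g i))"
  by (induction S rule: infinite_finite_induct) (simp_all add: vlin_add vlin_zero)

lemma vlin_lin_ext: "vlin (lin_ext f)"
  by (simp add: vlin_def lin_ext_add lin_ext_vscale)

lemma vlin_comp: "vlin F \<Longrightarrow> vlin H \<Longrightarrow> vlin (\<lambda>v. F (H v))"
  by (simp add: vlin_def)

lemma vlin_plus: "vlin F \<Longrightarrow> vlin H \<Longrightarrow> vlin (\<lambda>v. F v + H v)"
  by (simp add: vlin_def algebra_simps)

lemma vlin_scaled: "vlin F \<Longrightarrow> vlin (\<lambda>v. vscale c (F v))"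
  by (simp add: vlin_def mult.commute)

lemma vlin_sums: "(\<And>i. i \<in> S \<Longrightarrow> vlin (F i)) \<Longrightarrow> vlin (\<lambda>v. \<Sum>i\<in>S. F i v)"
  by (simp add: vlin_def sum.distrib vscale_sum)

lemma vlin_const0: "vlin (\<lambda>v. 0)"
  by (simp add: vlin_def)

lemma vlin_ident: "vlin (\<lambda>v. v)"
  by (simp add: vlin_def)

lemma poly_mapping_vinduct [case_names basis add scale zero]:
  assumes "\<And>b. P (basis_vec b)" "\<And>v w. P v \<Longrightarrow> P w \<Longrightarrow> P (v + w)"
    "\<And>c v. P v \<Longrightarrow> P (vscale c v)" "P 0"
  shows "P v"
proof -
  have "P (\<Sum>b\<in>S. vscale (c b) (basis_vec b))" if "finite S" for S and c
    using that by induction (auto intro: assms)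
  from this[OF finite_keys, of "Poly_Mapping.lookup v" v] show ?thesis
    using lin_ext_id[of v] by (simp add: lin_ext_def)
qed

lemma vlin_eqI:
  assumes "vlin F" "vlin H" "\<And>b. F (basis_vec b) = H (basis_vec b)"
  shows "F v = H v"
  by (induction v rule: poly_mapping_vinduct) (simp_all add: assms vlin_add vlin_vscale vlin_zero)

section \<open>Sums with finite support\<close>

lemma Sum_any_bounded:
  fixes f :: "nat \<Rightarrow> 'a::comm_monoid_add"
  assumes "\<And>j. j \<ge> N \<Longrightarrow> f j = 0"
  shows "Sum_any f = sum f {..<N}"
proof (rule Sum_any.expand_superset)
  show "{j. f j \<noteq> 0} \<subseteq> {..<N}" using assms leI by blast
qed simp

lemma finite_support_bounded:
  fixes f :: "nat \<Rightarrow> 'a::zero"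
  assumes "\<And>j. j \<ge> N \<Longrightarrow> f j = 0"
  shows "finite {j. f j \<noteq> 0}"
proof (rule finite_subset)
  show "{j. f j \<noteq> 0} \<subseteq> {..<N}" using assms leI by blast
qed simp

lemma finite_support_add:
  fixes f g :: "'a \<Rightarrow> 'b::monoid_add"
  assumes "finite {j. f j \<noteq> 0}" "finite {j. g j \<noteq> 0}"
  shows "finite {j. f j + g j \<noteq> 0}"
  by (rule finite_subset[OF _ finite_UnI[OF assms]]) auto

lemma finite_support_vscale:
  assumes "finite {j. f j \<noteq> 0}" shows "finite {j. vscale c (f j) \<noteq> 0}"
  by (rule finite_subset[OF _ assms]) auto

lemma Sum_any_vscale:
  assumes "finite {j. f j \<noteq> 0}"
  shows "Sum_any (\<lambda>j. vscale c (f j)) = vscale c (Sum_any f)"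
proof -
  have "Sum_any (\<lambda>j. vscale c (f j)) = (\<Sum>j | f j \<noteq> 0. vscale c (f j))"
    by (rule Sum_any.expand_superset) (use assms in auto)
  then show ?thesis by (simp add: Sum_any.expand_set vscale_sum)
qed

text \<open>Additivity would fail where \<open>Sum_any\<close> falls back to 0 on an infinite
  support. Every vector is a finite combination of basis vectors, so finiteness on these is
  enough.\<close>

lemma vlin_Sum_any:
  assumes "\<And>j. vlin (F j)" "\<And>b. finite {j. F j (basis_vec b) \<noteq> 0}"
  shows "vlin (\<lambda>v. Sum_any (\<lambda>j. F j v))"
proof -
  have fin: "finite {j. F j v \<noteq> 0}" for v
    by (induction v rule: poly_mapping_vinduct)
      (simp_all add: assms vlin_add vlin_vscale vlin_zero finite_support_add finite_support_vscale)
  show ?thesis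
    by (rule vlinI) (simp_all add: vlin_add[OF assms(1)] vlin_vscale[OF assms(1)] Sum_any.distrib
        Sum_any_vscale fin)
qed

text \<open>A linear injection preserves the support of \<open>g\<close>, so both sides are the same
  finite sum, or both are 0 when the support is infinite. This spares a truncation argument.\<close>

lemma vlin_inj_Sum_any:
  assumes "vlin F" "\<And>v. F v = 0 \<Longrightarrow> v = 0"
  shows "F (Sum_any g) = Sum_any (\<lambda>j. F (g j))"
proof -
  have "F x = 0 \<longleftrightarrow> x = 0" for x using assms vlin_zero by metis
  then show ?thesis by (simp add: Sum_any.expand_set vlin_sum[OF assms(1)])
qed


section \<open>Creation and annihilation operators\<close>

definition creat :: "'m \<times> nat \<Rightarrow> 'm::finite VK \<Rightarrow> 'm VK" where
  "creat x = lin_ext (\<lambda>(M, \<beta>). basis_vec (add_mset x M, \<beta>))"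

text \<open>The partial derivative with respect to the letter x. The Gram matrix is left to the
  coefficients in \<open>heis_pos\<close>, so \<open>annih_creat\<close> holds independently of
  G.\<close>

definition annih :: "'m \<times> nat \<Rightarrow> 'm::finite VK \<Rightarrow> 'm VK" where
  "annih x = lin_ext (\<lambda>(M, \<beta>). vscale (of_nat (count M x)) (basis_vec (M - {#x#}, \<beta>)))"

definition charge :: "int^'m^'m \<Rightarrow> complex^'m \<Rightarrow> 'm::finite VK \<Rightarrow> 'm VK" where
  "charge G h = lin_ext (\<lambda>(M, \<beta>). vscale (hform G h (lattice_embed \<beta>)) (basis_vec (M, \<beta>)))"

lemma vlin_creat: "vlin (creat x)" and vlin_annih: "vlin (annih x)" and vlin_charge: "vlin (charge G h)"
  by (simp_all add: creat_def annih_def charge_def vlin_lin_ext)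

lemma vlin_heis: "vlin (heis G h n)"
  by (simp add: heis_def vlin_lin_ext)

lemmas vlin_intros = vlin_ident vlin_const0 vlin_plus vlin_scaled vlin_sums vlin_creat[THEN vlin_comp]
  vlin_annih[THEN vlin_comp] vlin_charge[THEN vlin_comp] vlin_heis[THEN vlin_comp]

lemma creat_basis [simp]: "creat x (basis_vec (M, \<beta>)) = basis_vec (add_mset x M, \<beta>)"
  by (simp add: creat_def)

lemma annih_basis [simp]:
  "annih x (basis_vec (M, \<beta>)) = vscale (of_nat (count M x)) (basis_vec (M - {#x#}, \<beta>))"
  by (simp add: annih_def)

lemma charge_basis [simp]:
  "charge G h (basis_vec (M, \<beta>)) = vscale (hform G h (lattice_embed \<beta>)) (basis_vec (M, \<beta>))"
  by (simp add: charge_def)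

lemma creat_creat: "creat x (creat y v) = creat y (creat x v)"
  by (rule vlin_eqI[where v=v])
    (auto intro!: vlin_intros simp: add_mset_commute)

lemma annih_annih: "annih x (annih y v) = annih y (annih x v)"
  by (rule vlin_eqI[where v=v])
    (auto intro!: vlin_intros simp: vlin_vscale[OF vlin_annih] diff_right_commute add_mset_commute mult.commute)

lemma annih_creat: "annih x (creat y v) = creat y (annih x v) + (if x = y then v else 0)"
proof (rule vlin_eqI[where v=v])
  show "vlin (\<lambda>v. creat y (annih x v) + (if x = y then v else 0))"
    by (cases "x = y") (auto intro!: vlin_intros)
  fix b :: "'a monomial \<times> (int^'a)"
  obtain M \<beta> where b: "b = (M, \<beta>)" by (cases b)
  show "annih x (creat y (basis_vec b)) = creat y (annih x (basis_vec b)) + (if x = y then basis_vec b else 0)"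
  proof (cases "x = y")
    case True
    \<comment> \<open>If y occurs in M, removing and restoring it gives M back; if not, its count is
      0 and the term with \<open>M - {#y#}\<close> drops out.\<close>
    then show ?thesis
      by (cases "y \<in># M")
        (auto simp: b vlin_vscale[OF vlin_creat] vscale_add_left add.commute not_in_iff
          vlin_zero[OF vlin_creat])
  next
    case False
    then show ?thesis by (simp add: b vlin_vscale[OF vlin_creat])
  qed
qed (auto intro!: vlin_intros)

lemma charge_creat: "charge G h (creat x v) = creat x (charge G h v)"
  by (rule vlin_eqI[where v=v])
    (auto intro!: vlin_intros simp: vlin_vscale[OF vlin_creat])

lemma charge_annih: "charge G h (annih x v) = annih x (charge G h v)"
  by (rule vlin_eqI[where v=v])
    (auto intro!: vlin_intros
      simp: vlin_vscale[OF vlin_annih] vlin_vscale[OF vlin_charge] mult.commute)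

lemma charge_charge: "charge G h (charge G g v) = charge G g (charge G h v)"
  by (rule vlin_eqI[where v=v])
    (auto intro!: vlin_intros simp: vlin_vscale[OF vlin_charge] mult.commute)

lemma heis_neg:
  assumes "n < 0"
  shows "heis G h n v = (\<Sum>i\<in>UNIV. vscale (h $ i) (creat (i, nat (- n) - 1) v))"
  by (rule vlin_eqI[where v=v], rule vlin_heis, (intro vlin_intros)[])
    (use assms in \<open>auto simp: heis_def\<close>)

lemma heis_pos:
  assumes "n > 0"
  shows "heis G h n v = (\<Sum>j\<in>UNIV. vscale (of_int n * hform G h (lattice_basis j)) (annih (j, nat n - 1) v))"
  by (rule vlin_eqI[where v=v], rule vlin_heis, (intro vlin_intros)[])
    (use assms in \<open>auto simp: heis_def\<close>)

lemma heis_0: "heis G h 0 v = charge G h v"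
  by (simp add: heis_def charge_def)

text \<open>The central term of [h(m), g(n)] lives at m + n = 0, so it cannot appear between modes
  of the same strict sign.\<close>

lemma heis_neg_commute:
  assumes "m < 0" "n < 0"
  shows "heis G h m (heis G g n v) = heis G g n (heis G h m v)"
  using assms
  by (simp add: heis_neg vlin_sum[OF vlin_creat] vlin_vscale[OF vlin_creat] vscale_sum)
    (subst sum.swap, simp add: creat_creat mult.commute)

lemma heis_pos_commute:
  assumes "m > 0" "n > 0"
  shows "heis G h m (heis G g n v) = heis G g n (heis G h m v)"
  using assms
  by (simp add: heis_pos vlin_sum[OF vlin_annih] vlin_vscale[OF vlin_annih] vscale_sum)
    (subst sum.swap, simp add: annih_annih mult.commute mult.left_commute)

lemma heis_0_commute: "heis G h 0 (heis G g n v) = heis G g n (heis G h 0 v)"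
proof -
  consider "n < 0" | "n = 0" | "n > 0" by linarith
  then show ?thesis
    by cases
      (simp_all add: heis_0 heis_neg heis_pos charge_charge vlin_sum[OF vlin_charge]
        vlin_vscale[OF vlin_charge] charge_creat charge_annih)
qed

lemma heis_nonneg_commute:
  assumes "m \<ge> 0" "n \<ge> 0"
  shows "heis G h m (heis G g n v) = heis G g n (heis G h m v)"
  using assms heis_pos_commute[of m n] heis_0_commute[of G h g n v] heis_0_commute[of G g h m v]
  by (cases "m = 0"; cases "n = 0") auto

text \<open>The Heisenberg relation [h(n), alpha_i(-k-1)] = n (h, alpha_i) for n = k+1 and 0
  otherwise; the letter (i, k) carries the index shift.\<close>

lemma heis_pos_creat:
  assumes "n > 0"
  shows "heis G h n (creat (i, k) v) = creat (i, k) (heis G h n v) +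
    (if n = int (Suc k) then vscale (of_nat (Suc k) * hform G h (lattice_basis i)) v else 0)"
proof -
  have eq: "(j, nat n - 1) = (i, k) \<longleftrightarrow> j = i \<and> n = int (Suc k)" for j
    using assms by auto
  have "(\<Sum>j\<in>UNIV. vscale (of_int n * hform G h (lattice_basis j)) (if (j, nat n - 1) = (i, k) then v else 0))
      = (\<Sum>j\<in>UNIV. if j = i then if n = int (Suc k)
          then vscale (of_nat (Suc k) * hform G h (lattice_basis i)) v else 0 else 0)"
    unfolding eq by (intro sum.cong) auto
  then show ?thesis
    using assms
    by (simp add: heis_pos annih_creat vlin_sum[OF vlin_creat] vlin_vscale[OF vlin_creat] sum.distrib)
qed


section \<open>Fields\<close>

definition is_field :: "'m::finite field \<Rightarrow> bool" where
  "is_field a \<longleftrightarrow> (\<forall>n. vlin (a n)) \<and> (\<forall>w. \<exists>N. \<forall>n\<ge>N. a n w = 0)"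

lemma is_field_vlin: "is_field a \<Longrightarrow> vlin (a n)"
  by (simp add: is_field_def)

lemma is_field_truncated: "is_field a \<Longrightarrow> \<exists>N. \<forall>n\<ge>N. a n w = 0"
  by (simp add: is_field_def)

lemma is_fieldI:
  assumes "\<And>n. vlin (a n)" "\<And>b. \<exists>N. \<forall>n\<ge>N. a n (basis_vec b) = 0"
  shows "is_field a"
proof -
  have "\<exists>N. \<forall>n\<ge>N. a n w = 0" for w
  proof (induction w rule: poly_mapping_vinduct)
    case (add v w)
    then obtain N N' where "\<forall>n\<ge>N. a n v = 0" "\<forall>n\<ge>N'. a n w = 0" by blast
    then show ?case by (intro exI[of _ "max N N'"]) (simp add: vlin_add[OF assms(1)])
  next
    case (scale c v)
    then show ?case by (metis vlin_vscale[OF assms(1)] vscale_simps(3))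
  qed (use assms vlin_zero[OF assms(1)] in auto)
  then show ?thesis by (simp add: is_field_def assms)
qed

lemma is_field_truncated_nat:
  assumes "is_field a" shows "\<exists>N::nat. \<forall>j\<ge>N. a (m + int j) w = 0"
proof -
  obtain N where "\<forall>n\<ge>N. a n w = 0" using is_field_truncated[OF assms] by blast
  then show ?thesis by (intro exI[of _ "nat (N - m)"]) auto
qed

lemma is_field_zero: "is_field (\<lambda>n w. 0)"
  by (auto simp: is_field_def vlin_const0)

lemma is_field_add:
  assumes "is_field a" "is_field b" shows "is_field (\<lambda>n w. a n w + b n w)"
proof (rule is_fieldI)
  fix x
  obtain N N' where "\<forall>n\<ge>N. a n (basis_vec x) = 0" "\<forall>n\<ge>N'. b n (basis_vec x) = 0"
    using assms is_field_truncated by metis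
  then show "\<exists>N. \<forall>n\<ge>N. a n (basis_vec x) + b n (basis_vec x) = 0"
    by (intro exI[of _ "max N N'"]) auto
qed (intro vlin_plus is_field_vlin assms)

lemma is_field_vscale:
  assumes "is_field a" shows "is_field (\<lambda>n w. vscale c (a n w))"
proof (rule is_fieldI)
  show "\<exists>N. \<forall>n\<ge>N. vscale c (a n (basis_vec x)) = 0" for x
    using is_field_truncated[OF assms, of "basis_vec x"] by (metis vscale_simps(3))
qed (intro vlin_scaled is_field_vlin assms)

lemma is_field_shift:
  assumes "is_field a" shows "is_field (\<lambda>n. a (n + m))"
proof (rule is_fieldI)
  fix x
  obtain N where "\<forall>n\<ge>N. a n (basis_vec x) = 0" using is_field_truncated[OF assms] by blast
  then show "\<exists>N. \<forall>n\<ge>N. a (n + m) (basis_vec x) = 0" by (intro exI[of _ "N - m"]) auto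
qed (intro is_field_vlin assms)

lemma is_field_sum:
  assumes "finite S" "\<And>t. t \<in> S \<Longrightarrow> is_field (b t)" shows "is_field (\<lambda>n w. \<Sum>t\<in>S. b t n w)"
  using assms by induction (simp_all add: is_field_zero is_field_add)

lemma is_field_heis: "is_field (heis G h)"
proof (rule is_fieldI)
  fix b :: "'a monomial \<times> (int^'a)"
  obtain M \<beta> where b: "b = (M, \<beta>)" by (cases b)
  \<comment> \<open>N exceeds every second index occurring in M. The mode n removes letters with
    second index n - 1, hence the bound N + 1 below.\<close>
  obtain N where N: "\<And>i k. (i, k) \<in># M \<Longrightarrow> k < N"
  proof
    fix i k assume "(i, k) \<in># M"
    then have "k \<le> Max (snd ` set_mset M)" by (force intro!: Max_ge)
    then show "k < Suc (Max (snd ` set_mset M))" by simp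
  qed
  have "heis G h n (basis_vec b) = 0" if "n \<ge> int N + 1" for n
  proof -
    have "(j, nat n - 1) \<notin># M" for j using N[of j "nat n - 1"] that by fastforce
    then have "count M (j, nat n - 1) = 0" for j by (simp add: count_eq_zero_iff)
    then show ?thesis using that by (simp add: b heis_pos)
  qed
  then show "\<exists>N. \<forall>n\<ge>N. heis G h n (basis_vec b) = 0" by blast
qed (rule vlin_heis)

lemma is_field_div_deriv:
  assumes "is_field a" shows "is_field (div_deriv k a)"
proof (rule is_fieldI)
  fix x
  obtain N where "\<forall>n\<ge>N. a n (basis_vec x) = 0" using is_field_truncated[OF assms] by blast
  then show "\<exists>N. \<forall>n\<ge>N. div_deriv k a n (basis_vec x) = 0"
    by (intro exI[of _ "N + int k"]) (auto simp: div_deriv_def)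
qed (unfold div_deriv_def, intro vlin_scaled is_field_vlin assms)

lemma nop_finite_support:
  assumes "is_field a" "is_field b"
  shows "finite {j::nat. a (- int j - 1) (b (n + int j) w) \<noteq> 0}"
    and "finite {j::nat. b (n - int j - 1) (a (int j) w) \<noteq> 0}"
proof -
  obtain N :: nat where "\<forall>j\<ge>N. b (n + int j) w = 0"
    using is_field_truncated_nat[OF assms(2)] by blast
  then show "finite {j::nat. a (- int j - 1) (b (n + int j) w) \<noteq> 0}"
    by (intro finite_support_bounded[of N]) (simp add: vlin_zero is_field_vlin assms)
  obtain N :: nat where "\<forall>j\<ge>N. a (int j) w = 0"
    using is_field_truncated_nat[OF assms(1), of 0] by auto
  then show "finite {j::nat. b (n - int j - 1) (a (int j) w) \<noteq> 0}"
    by (intro finite_support_bounded[of N]) (simp add: vlin_zero is_field_vlin assms)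
qed

lemma is_field_nop:
  fixes a b :: "'m::finite field"
  assumes a: "is_field a" and b: "is_field b" shows "is_field (nop a b)"
proof (rule is_fieldI)
  fix n
  have 1: "vlin (\<lambda>w. a (- int j - 1) (b (n + int j) w))" 
    and 2: "vlin (\<lambda>w. b (n - int j - 1) (a (int j) w))" for j
    by (rule vlin_comp; rule is_field_vlin; fact)+
  show "vlin (nop a b n)"
    unfolding nop_def
    by (rule vlin_plus; rule vlin_Sum_any) (rule 1 2 nop_finite_support a b)+
next
  fix x :: "'m monomial \<times> (int^'m)"
  let ?w = "basis_vec x"
  obtain N1 where N1: "\<And>n. n \<ge> N1 \<Longrightarrow> b n ?w = 0" using is_field_truncated[OF b] by blast
  obtain N2 :: nat where N2: "\<And>j. j \<ge> N2 \<Longrightarrow> a (int j) ?w = 0"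
    using is_field_truncated_nat[OF a, of 0] by auto
  have "\<forall>j. \<exists>N. \<forall>n\<ge>N. b n (a (int j) ?w) = 0" using is_field_truncated[OF b] by blast
  then obtain M :: "nat \<Rightarrow> int" where M: "\<And>j n. n \<ge> M j \<Longrightarrow> b n (a (int j) ?w) = 0" by metis
  \<comment> \<open>The truncation bound of b on a_j w depends on j, but a_j w vanishes for j >= N2,
    so a maximum over finitely many j suffices.\<close>
  define N where "N = Max (insert N1 ((\<lambda>j::nat. M j + int j + 1) ` {..<N2}))"
  have "nop a b n ?w = 0" if n: "n \<ge> N" for n
  proof -
    have "N1 \<le> N" unfolding N_def by (intro Max_ge) auto
    then have 1: "a (- int j - 1) (b (n + int j) ?w) = 0" for j
      using n by (simp add: N1 vlin_zero is_field_vlin a)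
    have 2: "b (n - int j - 1) (a (int j) ?w) = 0" for j
    proof (cases "j < N2")
      case True
      then have "M j + int j + 1 \<le> N" unfolding N_def by (intro Max_ge) auto
      then show ?thesis using n by (intro M) simp
    qed (simp add: N2 vlin_zero is_field_vlin b)
    show ?thesis by (simp add: nop_def 1 2)
  qed
  then show "\<exists>N. \<forall>n\<ge>N. nop a b n ?w = 0" by blast
qed

section \<open>Normally ordered products: linearity in the second factor, commutation of nested
  products\<close>

lemma nop_add_right:
  assumes "is_field a" "is_field b" "is_field c"
  shows "nop a (\<lambda>n w. b n w + c n w) n w = nop a b n w + nop a c n w"
  by (simp add: nop_def vlin_add is_field_vlin assms Sum_any.distrib nop_finite_support add_ac)

lemma nop_vscale_right:
  assumes "is_field a" "is_field b"
  shows "nop a (\<lambda>n w. vscale c (b n w)) n w = vscale c (nop a b n w)"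
  by (simp add: nop_def vlin_vscale is_field_vlin assms Sum_any_vscale nop_finite_support)

lemma nop_zero_right:
  assumes "is_field a" shows "nop a (\<lambda>n w. 0) n w = 0"
  by (simp add: nop_def vlin_zero is_field_vlin assms)

lemma nop_sum_right:
  assumes "finite S" "is_field a" "\<And>t. t \<in> S \<Longrightarrow> is_field (b t)"
  shows "nop a (\<lambda>n w. \<Sum>t\<in>S. b t n w) n w = (\<Sum>t\<in>S. nop a (b t) n w)"
  using assms(1,3)
  by induction (simp_all add: nop_zero_right nop_add_right is_field_sum assms(2))

lemma nop_shift_right: "nop a (\<lambda>n. b (n + m)) n w = nop a b (n + m) w"
  by (simp add: nop_def algebra_simps)

text \<open>Each of a and b acts either to the left or to the right of c, which gives four blocks.
  One common cutoff N makes all of them finite sums over the same square, so that the two nesting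
  orders can be compared block by block.\<close>

lemma nop_nop_expand:
  fixes a b c :: "'m::finite field" and N :: nat
  assumes f: "is_field a" "is_field b" "is_field c"
    and comm: "\<And>i j v. a (int i) (b (int j) v) = b (int j) (a (int i) v)"
    and N: "\<And>j. j \<ge> N \<Longrightarrow> a (int j) w = 0" "\<And>j. j \<ge> N \<Longrightarrow> b (int j) w = 0"
      "\<And>j. j \<ge> N \<Longrightarrow> c (n + int j) w = 0"
      "\<And>i j. j \<ge> N \<Longrightarrow> c (n + int j - int i - 1) (a (int i) w) = 0"
      "\<And>i j. j \<ge> N \<Longrightarrow> c (n + int j - int i - 1) (b (int i) w) = 0"
  shows "nop a (nop b c) n w =
    (\<Sum>j<N. \<Sum>i<N. a (- int j - 1) (b (- int i - 1) (c (n + int j + int i) w))) +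
    (\<Sum>j<N. \<Sum>i<N. a (- int j - 1) (c (n + int j - int i - 1) (b (int i) w))) +
    (\<Sum>j<N. \<Sum>i<N. b (- int i - 1) (c (n + int i - int j - 1) (a (int j) w))) +
    (\<Sum>j<N. \<Sum>i<N. c (n - int j - int i - 2) (b (int i) (a (int j) w)))"
proof -
  note lin = vlin_zero is_field_vlin f
  have c3: "c (n + int j + int i) w = 0" if "i \<ge> N \<or> j \<ge> N" for i j
    using N(3)[of "i + j"] that by (auto simp: algebra_simps)
  have 1: "nop b c (n + int j) w = (\<Sum>i<N. b (- int i - 1) (c (n + int j + int i) w)) +
      (\<Sum>i<N. c (n + int j - int i - 1) (b (int i) w))" for j
    unfolding nop_def by (subst (1 2) Sum_any_bounded[of N]) (auto simp: c3 N(2) lin)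
  have 2: "nop b c (n - int j - 1) (a (int j) w) =
      (\<Sum>i<N. b (- int i - 1) (c (n + int i - int j - 1) (a (int j) w))) +
      (\<Sum>i<N. c (n - int j - int i - 2) (b (int i) (a (int j) w)))" for j
  proof -
    have e: "n - int j - 1 + int i = n + int i - int j - 1" 
      "n - int j - 1 - int i - 1 = n - int j - int i - 2" for i by simp_all
    \<comment> \<open>Truncation of b is known on w only, so b is first moved past a.\<close>
    have z: "b (int i) (a (int j) w) = 0" if "i \<ge> N" for i
      using N(2)[OF that] comm[of j i w] by (simp add: lin)
    show ?thesis
      unfolding nop_def e
      by (subst (1 2) Sum_any_bounded[of N]) (auto simp: N(4) z lin)
  qed
  have "nop a (nop b c) n w = (\<Sum>j<N. a (- int j - 1) (nop b c (n + int j) w)) +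
      (\<Sum>j<N. nop b c (n - int j - 1) (a (int j) w))"
    unfolding nop_def[of a]
    by (subst (1 2) Sum_any_bounded[of N])
      (auto simp: 1 c3 N(5) N(1) lin vlin_zero[OF is_field_vlin[OF is_field_nop]])
  then show ?thesis
    unfolding 1 2 by (simp add: vlin_add vlin_sum is_field_vlin f sum.distrib add.assoc)
qed

text \<open>Exchanging a and b matches the two pure blocks through commutation of modes on the same
  side of c, while the two mixed blocks merely trade places. Modes of opposite sign, where central
  terms arise, are never exchanged.\<close>

lemma nop_left_commute:
  fixes a b c :: "'m::finite field"
  assumes f: "is_field a" "is_field b" "is_field c"
    and pos: "\<And>i j v. a (int i) (b (int j) v) = b (int j) (a (int i) v)"
    and neg: "\<And>i j v. a (- int i - 1) (b (- int j - 1) v) = b (- int j - 1) (a (- int i - 1) v)"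
  shows "nop a (nop b c) = nop b (nop a c)"
proof (intro ext)
  fix n w
  obtain A where A: "\<And>j. j \<ge> A \<Longrightarrow> a (int j) w = 0"
    using is_field_truncated_nat[OF f(1), of 0] by auto
  obtain B where B: "\<And>j. j \<ge> B \<Longrightarrow> b (int j) w = 0"
    using is_field_truncated_nat[OF f(2), of 0] by auto
  obtain C where C: "\<And>j. j \<ge> C \<Longrightarrow> c (n + int j) w = 0"
    using is_field_truncated_nat[OF f(3)] by blast
  \<comment> \<open>The bound has to be uniform in i; since d_i w = 0 for i >= D, finitely many i
    decide it.\<close>
  have bd: "\<exists>K. \<forall>i j. j \<ge> K \<longrightarrow> c (n + int j - int i - 1) (d (int i) w) = 0"
    if D: "\<And>j. j \<ge> D \<Longrightarrow> d (int j) w = 0" for d :: "'m field" and D :: nat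
  proof -
    have "\<forall>i. \<exists>K. \<forall>j\<ge>K. c ((n - int i - 1) + int j) (d (int i) w) = 0"
      using is_field_truncated_nat[OF f(3)] by blast
    then obtain k where k: "\<And>i j. j \<ge> k i \<Longrightarrow> c ((n - int i - 1) + int j) (d (int i) w) = 0"
      by metis
    have "c (n + int j - int i - 1) (d (int i) w) = 0" if "j \<ge> Max (insert 0 (k ` {..<D}))" for i j
    proof (cases "i < D")
      case True
      then have "k i \<le> Max (insert 0 (k ` {..<D}))" by (intro Max_ge) auto
      then show ?thesis using k[of i j] that by (simp add: algebra_simps)
    qed (simp add: D vlin_zero is_field_vlin f)
    then show ?thesis by blast
  qed
  from bd[of A a, OF A] obtain K1 where
    K1: "\<And>i j. j \<ge> K1 \<Longrightarrow> c (n + int j - int i - 1) (a (int i) w) = 0" by blast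
  from bd[of B b, OF B] obtain K2 where
    K2: "\<And>i j. j \<ge> K2 \<Longrightarrow> c (n + int j - int i - 1) (b (int i) w) = 0" by blast
  define N where "N = A + B + C + K1 + K2"
  have NA: "a (int j) w = 0" and NB: "b (int j) w = 0" and NC: "c (n + int j) w = 0"
    and NK1: "c (n + int j - int i - 1) (a (int i) w) = 0"
    and NK2: "c (n + int j - int i - 1) (b (int i) w) = 0" if "j \<ge> N" for i j
    using that A[of j] B[of j] C[of j] K1[of j i] K2[of j i] by (simp_all add: N_def)
  have 1: "nop a (nop b c) n w =
    (\<Sum>j<N. \<Sum>i<N. a (- int j - 1) (b (- int i - 1) (c (n + int j + int i) w))) +
    (\<Sum>j<N. \<Sum>i<N. a (- int j - 1) (c (n + int j - int i - 1) (b (int i) w))) +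
    (\<Sum>j<N. \<Sum>i<N. b (- int i - 1) (c (n + int i - int j - 1) (a (int j) w))) +
    (\<Sum>j<N. \<Sum>i<N. c (n - int j - int i - 2) (b (int i) (a (int j) w)))"
    by (rule nop_nop_expand[OF f pos NA NB NC NK1 NK2])
  have 2: "nop b (nop a c) n w =
    (\<Sum>j<N. \<Sum>i<N. b (- int j - 1) (a (- int i - 1) (c (n + int j + int i) w))) +
    (\<Sum>j<N. \<Sum>i<N. b (- int j - 1) (c (n + int j - int i - 1) (a (int i) w))) +
    (\<Sum>j<N. \<Sum>i<N. a (- int i - 1) (c (n + int i - int j - 1) (b (int j) w))) +
    (\<Sum>j<N. \<Sum>i<N. c (n - int j - int i - 2) (a (int i) (b (int j) w)))"
    by (rule nop_nop_expand[OF f(2,1,3) pos[symmetric] NB NA NC NK2 NK1])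
  have s1: "(\<Sum>j<N. \<Sum>i<N. a (- int j - 1) (b (- int i - 1) (c (n + int j + int i) w)))
      = (\<Sum>j<N. \<Sum>i<N. b (- int j - 1) (a (- int i - 1) (c (n + int j + int i) w)))"
    by (subst sum.swap) (simp add: neg add.commute add.left_commute)
  have s4: "(\<Sum>j<N. \<Sum>i<N. c (n - int j - int i - 2) (b (int i) (a (int j) w)))
      = (\<Sum>j<N. \<Sum>i<N. c (n - int j - int i - 2) (a (int i) (b (int j) w)))"
    by (subst sum.swap) (simp add: pos algebra_simps)
  have s2: "(\<Sum>j<N. \<Sum>i<N. a (- int j - 1) (c (n + int j - int i - 1) (b (int i) w)))
      = (\<Sum>j<N. \<Sum>i<N. a (- int i - 1) (c (n + int i - int j - 1) (b (int j) w)))"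
    by (rule sum.swap)
  have s3: "(\<Sum>j<N. \<Sum>i<N. b (- int i - 1) (c (n + int i - int j - 1) (a (int j) w)))
      = (\<Sum>j<N. \<Sum>i<N. b (- int j - 1) (c (n + int j - int i - 1) (a (int i) w)))"
    by (rule sum.swap)
  show "nop a (nop b c) n w = nop b (nop a c) n w"
    unfolding 1 2 s1 s2 s3 s4 by (simp add: add.commute add.left_commute)
qed


section \<open>Exponentials of annihilation operators\<close>

lemma vlin_ser_pow:
  assumes "\<And>k. vlin (A k)" shows "vlin (ser_pow A r n)"
proof (induction r arbitrary: n)
  case 0
  then show ?case by (cases "n = 0") (simp_all add: vlin_def)
next
  case (Suc r)
  then show ?case by (simp add: vlin_def vlin_add[OF assms] vlin_vscale[OF assms] sum.distrib vscale_sum)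
qed

lemma vlin_ser_exp:
  assumes "\<And>k. vlin (A k)" shows "vlin (ser_exp A n)"
  unfolding ser_exp_def by (intro vlin_sums vlin_scaled vlin_ser_pow assms)

lemma ser_pow_eq_0:
  assumes "\<And>k. vlin (A k)" "n < r" shows "ser_pow A r n v = 0"
  using assms(2)
proof (induction r arbitrary: n)
  case (Suc r)
  have "A k (ser_pow A r (n - k) v) = 0" if "k \<in> {1..n}" for k
    using that Suc.prems by (subst Suc.IH) (auto simp: vlin_zero[OF assms(1)])
  then show ?case by simp
qed simp

text \<open>The commutator of A(x) with X is the scalar c x^d, so bracketing with X acts on powers
  of A(x) like a derivation: A^r yields r c x^d A^(r-1).\<close>

lemma ser_pow_commutator:
  assumes A: "\<And>k. vlin (A k)" and X: "vlin X" and d: "d \<ge> 1"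
    and comm: "\<And>k v. k \<ge> 1 \<Longrightarrow> A k (X v) = X (A k v) + (if k = d then vscale c v else 0)"
  shows "ser_pow A r n (X v) = X (ser_pow A r n v) +
    (if d \<le> n then vscale (of_nat r * c) (ser_pow A (r - 1) (n - d) v) else 0)"
proof (induction r arbitrary: n)
  case 0
  then show ?case by (simp add: vlin_zero[OF X])
next
  case (Suc r)
  let ?R = "\<lambda>k. if d \<le> n - k then vscale (of_nat r * c) (A k (ser_pow A (r - 1) (n - k - d) v)) else 0"
  have "A k (ser_pow A r (n - k) (X v)) = X (A k (ser_pow A r (n - k) v)) +
      (if k = d then vscale c (ser_pow A r (n - k) v) else 0) + ?R k" if "k \<in> {1..n}" for k
    using that unfolding Suc by (auto simp: vlin_add[OF A] vlin_vscale[OF A] vlin_zero[OF A] comm)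
  then have "ser_pow A (Suc r) n (X v) = X (ser_pow A (Suc r) n v) +
      (\<Sum>k=1..n. if k = d then vscale c (ser_pow A r (n - k) v) else 0) + (\<Sum>k=1..n. ?R k)"
    by (simp add: sum.distrib vlin_sum[OF X])
  also have "(\<Sum>k=1..n. if k = d then vscale c (ser_pow A r (n - k) v) else 0) =
      (if d \<le> n then vscale c (ser_pow A r (n - d) v) else 0)"
    using d by simp
  also have "(\<Sum>k=1..n. ?R k) = (if d \<le> n then vscale (of_nat r * c) (ser_pow A r (n - d) v) else 0)"
  \<comment> \<open>At r = 0 the factor \<open>of_nat r\<close> vanishes, so the truncated exponent
    \<open>r - 1\<close> is harmless; otherwise one more A turns the power r - 1 into r.\<close>
  proof (cases r)
    case (Suc r')
    have "(\<Sum>k=1..n. ?R k) = (\<Sum>k=1..n - d. vscale (of_nat r * c) (A k (ser_pow A r' (n - d - k) v)))"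
      using d by (intro sum.mono_neutral_cong_right) (auto simp: Suc add.commute)
    then show ?thesis using Suc by (auto simp: vscale_sum)
  qed (auto intro!: sum.neutral)
  finally show ?case by (simp add: vscale_add_left algebra_simps)
qed

text \<open>Since r/r! = 1/(r-1)!, the power rule sums up to exp(A) X = (X + c x^d) exp(A).\<close>

lemma ser_exp_commutator:
  assumes A: "\<And>k. vlin (A k)" and X: "vlin X" and d: "d \<ge> 1"
    and comm: "\<And>k v. k \<ge> 1 \<Longrightarrow> A k (X v) = X (A k v) + (if k = d then vscale c v else 0)"
  shows "ser_exp A n (X v) = X (ser_exp A n v) +
    (if d \<le> n then vscale c (ser_exp A (n - d) v) else 0)"
proof -
  have *: "ser_pow A r n (X v) = X (ser_pow A r n v) +
      (if d \<le> n then vscale (of_nat r * c) (ser_pow A (r - 1) (n - d) v) else 0)" for r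
    by (rule ser_pow_commutator[OF A X d]) (rule comm)
  have "ser_exp A n (X v) = X (ser_exp A n v) + (\<Sum>r\<le>n. vscale (1 / fact r)
      (if d \<le> n then vscale (of_nat r * c) (ser_pow A (r - 1) (n - d) v) else 0))"
    unfolding ser_exp_def *
    by (simp add: sum.distrib vlin_sum[OF X] vlin_vscale[OF X])
  also have "(\<Sum>r\<le>n. vscale (1 / fact r)
      (if d \<le> n then vscale (of_nat r * c) (ser_pow A (r - 1) (n - d) v) else 0))
      = (if d \<le> n then vscale c (ser_exp A (n - d) v) else 0)"
  proof (cases "d \<le> n")
    case True
    then obtain n' where n': "n = Suc n'" using d by (cases n) auto
    have "(\<Sum>r\<le>n. vscale (1 / fact r) (vscale (of_nat r * c) (ser_pow A (r - 1) (n - d) v)))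
        = (\<Sum>r\<le>n'. vscale (1 / fact (Suc r)) (vscale (of_nat (Suc r) * c) (ser_pow A r (n - d) v)))"
      unfolding n' by (subst sum.atMost_Suc_shift) simp
    also have "\<dots> = (\<Sum>r\<le>n'. vscale c (vscale (1 / fact r) (ser_pow A r (n - d) v)))"
      by (intro sum.cong) (auto simp: field_simps simp del: of_nat_Suc)
    \<comment> \<open>A(x) has no constant term, so its r-th power contributes to x^(n-d) only for r
      <= n - d.\<close>
    also have "\<dots> = (\<Sum>r\<le>n - d. vscale c (vscale (1 / fact r) (ser_pow A r (n - d) v)))"
      using d n' by (intro sum.mono_neutral_right) (auto simp: ser_pow_eq_0[OF A])
    finally show ?thesis using True by (simp add: ser_exp_def vscale_sum)
  qed simp
  finally show ?thesis .
qed

lemma ser_exp_commute: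
  assumes "\<And>k. vlin (A k)" "vlin X" "\<And>k v. k \<ge> 1 \<Longrightarrow> A k (X v) = X (A k v)"
  shows "ser_exp A n (X v) = X (ser_exp A n v)"
  using ser_exp_commutator[of A X 1 0 n v] assms by simp

abbreviation heis_series :: "int^'m^'m \<Rightarrow> complex^'m \<Rightarrow> (nat \<Rightarrow> complex) \<Rightarrow> nat \<Rightarrow> 'm::finite VK \<Rightarrow> 'm VK" where
  "heis_series G u s \<equiv> (\<lambda>k w. vscale (s k) (heis G u (int k) w))"

lemma vlin_heis_series: "vlin (\<lambda>w. vscale c (heis G u n w))"
  by (intro vlin_scaled vlin_heis)

lemma ser_exp_heis_creat:
  "ser_exp (heis_series G u s) n (creat (i, k) v) = creat (i, k) (ser_exp (heis_series G u s) n v) +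
    (if Suc k \<le> n then vscale (s (Suc k) * of_nat (Suc k) * hform G u (lattice_basis i))
      (ser_exp (heis_series G u s) (n - Suc k) v) else 0)"
  by (rule ser_exp_commutator[OF vlin_heis_series vlin_creat])
    (auto simp: heis_pos_creat vlin_vscale[OF vlin_creat] mult.assoc simp del: of_nat_Suc)

lemma ser_exp_heis_empty:
  "ser_exp (heis_series G u s) n (basis_vec ({#}, \<beta>)) = (if n = 0 then basis_vec ({#}, \<beta>) else 0)"
proof -
  have "heis G u (int k) (basis_vec ({#}, \<beta>)) = 0" if "k \<ge> 1" for k
    using that by (simp add: heis_pos)
  then have "ser_pow (heis_series G u s) r n (basis_vec ({#}, \<beta>)) =
      (if r = 0 \<and> n = 0 then basis_vec ({#}, \<beta>) else 0)" for r n
    by (induction r arbitrary: n) (auto intro!: sum.neutral)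
  then show ?thesis
    by (auto simp: ser_exp_def if_distrib[of "vscale _"] intro!: sum.neutral cong: if_cong)
qed

text \<open>
  The coefficients of \<open>x^(-n)\<close> in the product of the \<open>\<alpha>_i(-k-1) + c(i,k) x^(-k-1)\<close>, over the
  letters \<open>(i,k)\<close> of a word, applied to \<open>e^\<alpha>\<close>.
\<close>
fun shifted_word :: "('m \<times> nat \<Rightarrow> complex) \<Rightarrow> ('m \<times> nat) list \<Rightarrow> int^'m \<Rightarrow> nat \<Rightarrow> 'm::finite VK" where
  "shifted_word c [] \<alpha> n = (if n = 0 then basis_vec ({#}, \<alpha>) else 0)"
| "shifted_word c (x # ws) \<alpha> n = creat x (shifted_word c ws \<alpha> n) +
     (if Suc (snd x) \<le> n then vscale (c x) (shifted_word c ws \<alpha> (n - Suc (snd x))) else 0)"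

definition word_degree :: "('m \<times> nat) list \<Rightarrow> nat" where
  "word_degree ws = (\<Sum>x\<leftarrow>ws. Suc (snd x))"

lemma shifted_word_eq_0: "n > word_degree ws \<Longrightarrow> shifted_word c ws \<alpha> n = 0"
  by (induction ws arbitrary: n) (auto simp: word_degree_def vlin_zero[OF vlin_creat])

text \<open>Moving the exponential past one letter, by \<open>ser_exp_heis_creat\<close>, reproduces
  the recursion of \<open>shifted_word\<close>; the exponential fixes e^alpha.\<close>

lemma ser_exp_heis_word:
  "ser_exp (heis_series G u s) n (basis_vec (mset ws, \<alpha>)) =
    shifted_word (\<lambda>(i, k). s (Suc k) * of_nat (Suc k) * hform G u (lattice_basis i)) ws \<alpha> n"
proof (induction ws arbitrary: n)
  case Nil
  then show ?case by (simp add: ser_exp_heis_empty)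
next
  case (Cons x ws)
  obtain i k where x: "x = (i, k)" by (cases x)
  have "ser_exp (heis_series G u s) n (basis_vec (mset (x # ws), \<alpha>)) =
      ser_exp (heis_series G u s) n (creat (i, k) (basis_vec (mset ws, \<alpha>)))"
    by (simp add: x)
  then show ?case unfolding ser_exp_heis_creat Cons.IH by (simp add: x)
qed

lemma ser_exp_heis_eventually_0:
  "\<exists>N. \<forall>n\<ge>N. ser_exp (heis_series G u s) n (basis_vec (M, \<alpha>)) = 0"
proof -
  obtain ws where "M = mset ws" using ex_mset by metis
  then show ?thesis
    by (intro exI[of _ "Suc (word_degree ws)"]) (simp add: ser_exp_heis_word shifted_word_eq_0)
qed


section \<open>Vertex operators as fields\<close>

lemma is_field_exp_field: "is_field (exp_field G \<epsilon> \<alpha>)"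
proof (rule is_fieldI)
  fix b :: "'a monomial \<times> (int^'a)"
  obtain M \<beta> where b: "b = (M, \<beta>)" by (cases b)
  let ?E = "\<lambda>b. ser_exp (heis_series G (lattice_embed \<alpha>) (\<lambda>k. - 1 / of_nat k)) b (basis_vec (M, \<alpha> + \<beta>))"
  obtain N where N: "\<And>b. b \<ge> N \<Longrightarrow> ?E b = 0"
    using ser_exp_heis_eventually_0[where s="\<lambda>k. - 1 / of_nat k"] by blast
  \<comment> \<open>For such n, a summand with b < N has a negative exponent a, and one with b >= N
    is killed by the annihilation exponential.\<close>
  have "exp_field G \<epsilon> \<alpha> n (basis_vec b) = 0" if n: "n \<ge> int N - zform G \<alpha> \<beta>" for n
  proof -
    have *: "(\<lambda>b::nat. let a = int b - zform G \<alpha> \<beta> - n - 1 in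
       if a < 0 then 0
       else ser_exp (\<lambda>k v. vscale (1 / of_nat k) (heis G (lattice_embed \<alpha>) (- int k) v)) (nat a) (?E b))
       = (\<lambda>_. 0)"
    proof
      fix b :: nat
      show "(let a = int b - zform G \<alpha> \<beta> - n - 1 in
       if a < 0 then 0
       else ser_exp (\<lambda>k v. vscale (1 / of_nat k) (heis G (lattice_embed \<alpha>) (- int k) v)) (nat a) (?E b)) = 0"
      proof (cases "b \<ge> N")
        case True
        show ?thesis unfolding N[OF True]
          by (simp add: Let_def vlin_zero[OF vlin_ser_exp[OF vlin_heis_series]])
      qed (use n in simp)
    qed
    show ?thesis unfolding exp_field_def b lin_ext_basis prod.case * by simp
  qed
  then show "\<exists>N. \<forall>n\<ge>N. exp_field G \<epsilon> \<alpha> n (basis_vec b) = 0" by blast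
qed (simp add: exp_field_def vlin_lin_ext)

lemma is_field_word_field: "is_field (word_field G \<epsilon> ws \<alpha>)"
  by (induction ws) (auto intro!: is_field_exp_field is_field_nop is_field_div_deriv is_field_heis)

text \<open>The mode i of the k-th derivative involves h(i-k), which may be a creation operator; but
  for 0 <= i < k the binomial coefficient vanishes, so only pairs of nonnegative Heisenberg modes
  remain.\<close>

lemma div_deriv_heis_commute_nonneg:
  "div_deriv k (heis G g) (int i) (div_deriv l (heis G h) (int j) v) =
   div_deriv l (heis G h) (int j) (div_deriv k (heis G g) (int i) v)"
proof -
  have z: "(of_nat m gchoose k :: complex) = 0" if "m < k" for m k
    using that by (simp add: binomial_gbinomial[symmetric])
  show ?thesis
  proof (cases "i < k \<or> j < l")
    case True
    then show ?thesis by (auto simp: div_deriv_def z)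
  next
    case False
    then show ?thesis
      by (simp add: div_deriv_def vlin_vscale[OF vlin_heis] heis_nonneg_commute[of "int i - int k"] mult.commute)
  qed
qed

lemma div_deriv_heis_commute_neg:
  "div_deriv k (heis G g) (- int i - 1) (div_deriv l (heis G h) (- int j - 1) v) =
   div_deriv l (heis G h) (- int j - 1) (div_deriv k (heis G g) (- int i - 1) v)"
  by (simp add: div_deriv_def vlin_vscale[OF vlin_heis] heis_neg_commute[of "- int i - 1 - int k"] mult.commute)

section \<open>Independence of the word chosen for a monomial\<close>

lemma word_field_move:
  "word_field G \<epsilon> (ys @ x # zs) \<alpha> = word_field G \<epsilon> (x # ys @ zs) \<alpha>"
proof (induction ys)
  case (Cons y ys)
  obtain i k j l where xy: "x = (i, k)" "y = (j, l)" by (cases x; cases y)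
  show ?case
    using Cons unfolding xy
    by (simp add: nop_left_commute is_field_div_deriv is_field_heis is_field_word_field
        div_deriv_heis_commute_nonneg div_deriv_heis_commute_neg)
qed simp

lemma word_field_mset_eq:
  "mset ws = mset ws' \<Longrightarrow> word_field G \<epsilon> ws \<alpha> = word_field G \<epsilon> ws' \<alpha>"
proof (induction ws arbitrary: ws')
  case (Cons x ws)
  then have "x \<in> set ws'" by (metis list.set_intros(1) set_mset_mset)
  then obtain ys zs where ws': "ws' = ys @ x # zs" by (meson split_list)
  then have "word_field G \<epsilon> ws \<alpha> = word_field G \<epsilon> (ys @ zs) \<alpha>"
    using Cons by simp
  then show ?case by (cases x) (simp add: ws' word_field_move)
qed simp

lemma vlin_vertex_op_left: "vlin (\<lambda>v. vertex_op G \<epsilon> v n w)"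
  by (simp add: vertex_op_def vlin_lin_ext)

lemma vertex_op_basis: "vertex_op G \<epsilon> (basis_vec (mset ws, \<alpha>)) n w = word_field G \<epsilon> ws \<alpha> n w"
  by (simp add: vertex_op_def word_field_mset_eq[OF word_of_mset])

lemma is_field_vertex_op: "is_field (vertex_op G \<epsilon> v)"
proof (induction v rule: poly_mapping_vinduct)
  case (basis b)
  obtain ws \<alpha> where "b = (mset ws, \<alpha>)" using ex_mset by (metis surj_pair)
  then have "vertex_op G \<epsilon> (basis_vec b) = word_field G \<epsilon> ws \<alpha>" by (intro ext) (simp add: vertex_op_basis)
  then show ?case by (simp add: is_field_word_field)
next
  case (add v w)
  then have "is_field (\<lambda>n x. vertex_op G \<epsilon> v n x + vertex_op G \<epsilon> w n x)" by (rule is_field_add)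
  then show ?case by (simp add: vlin_add[OF vlin_vertex_op_left, symmetric])
next
  case (scale c v)
  then have "is_field (\<lambda>n x. vscale c (vertex_op G \<epsilon> v n x))" by (rule is_field_vscale)
  then show ?case by (simp add: vlin_vscale[OF vlin_vertex_op_left, symmetric])
next
  case zero
  have "vertex_op G \<epsilon> 0 = (\<lambda>n w. 0)" by (intro ext) (simp add: vlin_zero[OF vlin_vertex_op_left])
  then show ?case by (simp add: is_field_zero)
qed

text \<open>On monomials this is the recursion of \<open>word_field\<close>. It is wanted for
  arbitrary v because \<open>shifted_word\<close> is a sum of monomials.\<close>

lemma vertex_op_creat:
  "vertex_op G \<epsilon> (creat (i, k) v) n w = nop (div_deriv k (heis G (lattice_basis i))) (vertex_op G \<epsilon> v) n w"
    (is "_ = nop ?a _ n w")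
proof -
  have a: "is_field ?a" by (intro is_field_div_deriv is_field_heis)
  have *: "vlin (\<lambda>v. nop ?a (vertex_op G \<epsilon> v) n w)"
  proof (rule vlinI)
    fix v v' :: "'a VK" and c
    have "vertex_op G \<epsilon> (v + v') = (\<lambda>n w. vertex_op G \<epsilon> v n w + vertex_op G \<epsilon> v' n w)"
      by (intro ext) (rule vlin_add[OF vlin_vertex_op_left])
    then show "nop ?a (vertex_op G \<epsilon> (v + v')) n w =
        nop ?a (vertex_op G \<epsilon> v) n w + nop ?a (vertex_op G \<epsilon> v') n w"
      by (simp add: nop_add_right a is_field_vertex_op)
    have "vertex_op G \<epsilon> (vscale c v) = (\<lambda>n w. vscale c (vertex_op G \<epsilon> v n w))"
      by (intro ext) (rule vlin_vscale[OF vlin_vertex_op_left])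
    then show "nop ?a (vertex_op G \<epsilon> (vscale c v)) n w = vscale c (nop ?a (vertex_op G \<epsilon> v) n w)"
      by (simp add: nop_vscale_right a is_field_vertex_op)
  qed
  show ?thesis
  proof (rule vlin_eqI[OF vlin_comp[OF vlin_vertex_op_left vlin_creat] *])
    fix b :: "'a monomial \<times> (int^'a)"
    obtain ws \<alpha> where b: "b = (mset ws, \<alpha>)" using ex_mset by (metis surj_pair)
    have "vertex_op G \<epsilon> (basis_vec (mset ws, \<alpha>)) = word_field G \<epsilon> ws \<alpha>"
      by (intro ext) (rule vertex_op_basis)
    then show "vertex_op G \<epsilon> (creat (i, k) (basis_vec b)) n w = nop ?a (vertex_op G \<epsilon> (basis_vec b)) n w"
      using vertex_op_basis[of G \<epsilon> "(i, k) # ws" \<alpha> n w] by (simp add: b)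
  qed
qed


section \<open>The twisted vertex operators\<close>

lemma vlin_xpow: "vlin (xpow G u t)"
  by (simp add: xpow_def vlin_lin_ext)

lemma xpow_creat: "xpow G u t (creat x v) = creat x (xpow G u t v)"
  by (rule vlin_eqI[where v=v], rule vlin_comp[OF vlin_xpow vlin_creat], rule vlin_comp[OF vlin_creat vlin_xpow])
    (auto simp: xpow_def vlin_zero[OF vlin_creat])

text \<open>The shift changes only the Heisenberg part and stays over e^alpha, which is a single
  eigenspace of u_0; hence the projection keeps all or nothing.\<close>

lemma xpow_shifted_word:
  "xpow G u t (shifted_word c ws \<alpha> n) =
    (if hform G u (lattice_embed \<alpha>) = of_int t then shifted_word c ws \<alpha> n else 0)"
proof (induction ws arbitrary: n)
  case Nil
  then show ?case by (simp add: xpow_def)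
next
  case (Cons x ws)
  then show ?case
    by (auto simp: vlin_add[OF vlin_xpow] vlin_vscale[OF vlin_xpow] vlin_zero[OF vlin_xpow]
        vlin_zero[OF vlin_creat] xpow_creat)
qed

text \<open>The sign is that of (1/k!) (d/dx)^k x^(-1) = (-1)^k x^(-k-1): the k-th derivative of
  alpha_i(x) is shifted by that of (u, alpha_i) x^(-1).\<close>

definition shift_scalar :: "int^'m^'m \<Rightarrow> complex^'m \<Rightarrow> 'm \<times> nat \<Rightarrow> complex" where
  "shift_scalar G u = (\<lambda>(i, k). (-1)^k * hform G u (lattice_basis i))"

lemma ser_exp_Delta:
  "ser_exp (heis_series G u (\<lambda>k. (-1)^k / (- of_nat k))) n (basis_vec (mset ws, \<alpha>)) =
    shifted_word (shift_scalar G u) ws \<alpha> n"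
proof -
  have "(-1)^Suc k / (- of_nat (Suc k)) * of_nat (Suc k) = ((-1)^k :: complex)" for k
    by (simp add: field_simps del: of_nat_Suc)
  then show ?thesis unfolding ser_exp_heis_word by (simp only: shift_scalar_def)
qed

lemma Delta_basis:
  assumes "hform G u (lattice_embed \<alpha>) = of_int p"
  shows "Delta G u s (basis_vec (mset ws, \<alpha>)) =
    (if s \<le> p then shifted_word (shift_scalar G u) ws \<alpha> (nat (p - s)) else 0)"
proof -
  have "(of_int p :: complex) = of_int (s + int n) \<longleftrightarrow> s \<le> p \<and> n = nat (p - s)" for n
    by (subst of_int_eq_iff) auto
  then show ?thesis
    unfolding Delta_def ser_exp_Delta xpow_shifted_word assms
    by (subst Sum_any_single[of "nat (p - s)"]) auto
qed

lemma vlin_Delta: "vlin (Delta G u s)"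
proof -
  have "finite {n::nat. xpow G u (s + int n)
     (ser_exp (heis_series G u (\<lambda>k. (-1)^k / (- of_nat k))) n (basis_vec b)) \<noteq> 0}" for b
  proof -
    obtain M \<alpha> where "b = (M, \<alpha>)" by (cases b)
    then obtain N where "\<And>n. n \<ge> N \<Longrightarrow>
        ser_exp (heis_series G u (\<lambda>k. (-1)^k / (- of_nat k))) n (basis_vec b) = 0"
      using ser_exp_heis_eventually_0[where s="\<lambda>k. (-1)^k / (- of_nat k)"] by blast
    then show ?thesis by (intro finite_support_bounded[of N]) (simp add: vlin_zero[OF vlin_xpow])
  qed
  then show ?thesis
    unfolding Delta_def
    by (intro vlin_Sum_any vlin_comp[OF vlin_xpow vlin_ser_exp[OF vlin_heis_series]])
qed

text \<open>Normally ordered product of the shifted Heisenberg fields with x^p Y(e^alpha, x).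
  Multiplication by x^p replaces the mode l by l + p, multiplication by x^(-k-1) replaces it by l -
  k - 1.\<close>

fun twisted_word_field :: "int^'m^'m \<Rightarrow> (int^'m \<Rightarrow> int^'m \<Rightarrow> complex) \<Rightarrow> ('m \<times> nat \<Rightarrow> complex)
    \<Rightarrow> int \<Rightarrow> ('m \<times> nat) list \<Rightarrow> int^'m \<Rightarrow> 'm::finite field" where
  "twisted_word_field G \<epsilon> c p [] \<alpha> = (\<lambda>l. exp_field G \<epsilon> \<alpha> (l + p))"
| "twisted_word_field G \<epsilon> c p ((i, k) # ws) \<alpha> = (\<lambda>l w.
     nop (div_deriv k (heis G (lattice_basis i))) (twisted_word_field G \<epsilon> c p ws \<alpha>) l w +
     vscale (c (i, k)) (twisted_word_field G \<epsilon> c p ws \<alpha> (l - int (Suc k)) w))"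

text \<open>Here t is the power of 1/x collected from the scalars. For a new letter, the creation
  part becomes a normally ordered product and the scalar part is the old sum with t raised by k +
  1.\<close>

lemma sum_vertex_op_shifted_word:
  "(\<Sum>t\<le>word_degree ws. vertex_op G \<epsilon> (shifted_word c ws \<alpha> t) (l + p - int t) w) =
    twisted_word_field G \<epsilon> c p ws \<alpha> l w"
proof (induction ws arbitrary: l w)
  case Nil
  then show ?case using vertex_op_basis[of G \<epsilon> "[]"] by (simp add: word_degree_def)
next
  case (Cons x ws)
  obtain i k where x: "x = (i, k)" by (cases x)
  let ?D = "word_degree ws" and ?S = "shifted_word c ws \<alpha>" and ?a = "div_deriv k (heis G (lattice_basis i))"
  let ?V = "\<lambda>t. vertex_op G \<epsilon> (?S t)"
  note lin = vlin_add[OF vlin_vertex_op_left] vlin_vscale[OF vlin_vertex_op_left] vlin_zero[OF vlin_vertex_op_left]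
  have D: "word_degree (x # ws) = ?D + Suc k" by (simp add: word_degree_def x)
  have a: "is_field ?a" by (intro is_field_div_deriv is_field_heis)
  have z: "?S t = 0" if "t > ?D" for t using that by (rule shifted_word_eq_0)
  have "(\<Sum>t\<le>?D + Suc k. vertex_op G \<epsilon> (shifted_word c (x # ws) \<alpha> t) (l + p - int t) w) =
      (\<Sum>t\<le>?D + Suc k. vertex_op G \<epsilon> (creat (i, k) (?S t)) (l + p - int t) w) +
      (\<Sum>t\<le>?D + Suc k. if Suc k \<le> t then vscale (c (i, k)) (?V (t - Suc k) (l + p - int t) w) else 0)"
    unfolding sum.distrib[symmetric] by (intro sum.cong) (auto simp: x lin)
  \<comment> \<open>The shifted word of \<open>ws\<close> has no terms beyond its degree, so the
    last k + 1 summands vanish.\<close>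
  also have "(\<Sum>t\<le>?D + Suc k. vertex_op G \<epsilon> (creat (i, k) (?S t)) (l + p - int t) w) =
      (\<Sum>t\<le>?D. vertex_op G \<epsilon> (creat (i, k) (?S t)) (l + p - int t) w)"
    by (intro sum.mono_neutral_right) (auto simp: z lin vlin_zero[OF vlin_creat])
  also have "\<dots> = (\<Sum>t\<le>?D. nop ?a (\<lambda>n. ?V t (n + (p - int t))) l w)"
    unfolding nop_shift_right vertex_op_creat by (simp add: add_diff_eq)
  also have "\<dots> = nop ?a (\<lambda>n w. \<Sum>t\<le>?D. ?V t (n + (p - int t)) w) l w"
    by (rule nop_sum_right[symmetric]) (auto intro: a is_field_shift is_field_vertex_op)
  also have "(\<lambda>n w. \<Sum>t\<le>?D. ?V t (n + (p - int t)) w) = twisted_word_field G \<epsilon> c p ws \<alpha>"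
    by (simp add: fun_eq_iff Cons.IH[symmetric] algebra_simps)
  also have "(\<Sum>t\<le>?D + Suc k. if Suc k \<le> t then vscale (c (i, k)) (?V (t - Suc k) (l + p - int t) w) else 0)
      = (\<Sum>t\<le>?D. vscale (c (i, k)) (?V t (l - int (Suc k) + p - int t) w))"
  proof -
    have "(\<Sum>t\<le>?D + Suc k. if Suc k \<le> t then vscale (c (i, k)) (?V (t - Suc k) (l + p - int t) w) else 0)
        = (\<Sum>t=0 + Suc k..?D + Suc k. vscale (c (i, k)) (?V (t - Suc k) (l + p - int t) w))"
      by (intro sum.mono_neutral_cong_right) auto
    also have "\<dots> = (\<Sum>t\<le>?D. vscale (c (i, k)) (?V t (l - int (Suc k) + p - int t) w))"
      unfolding sum.shift_bounds_cl_nat_ivl atMost_atLeast0 by (simp add: algebra_simps)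
    finally show ?thesis .
  qed
  also have "\<dots> = vscale (c (i, k)) (twisted_word_field G \<epsilon> c p ws \<alpha> (l - int (Suc k)) w)"
    unfolding Cons.IH[symmetric] by (simp add: vscale_sum)
  finally show ?case unfolding D by (simp add: x)
qed

lemma twisted_op_basis:
  assumes "hform G u (lattice_embed \<alpha>) = of_int p"
  shows "twisted_op G (shifted_lattice_voa G \<epsilon> q) u (basis_vec (mset ws, \<alpha>)) l w =
    twisted_word_field G \<epsilon> (shift_scalar G u) p ws \<alpha> l w"
proof -
  let ?S = "shifted_word (shift_scalar G u) ws \<alpha>" and ?D = "word_degree ws"
  let ?h = "\<lambda>s. vertex_op G \<epsilon> (if s \<le> p then ?S (nat (p - s)) else 0) (l + s) w"
  have "twisted_op G (shifted_lattice_voa G \<epsilon> q) u (basis_vec (mset ws, \<alpha>)) l w = Sum_any ?h"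
    by (simp add: twisted_op_def shifted_lattice_voa_def Delta_basis[OF assms])
  also have "\<dots> = sum ?h ((\<lambda>t. p - int t) ` {..?D})"
  proof (rule Sum_any.expand_superset)
    show "{s. ?h s \<noteq> 0} \<subseteq> (\<lambda>t. p - int t) ` {..?D}"
    proof
      fix s assume "s \<in> {s. ?h s \<noteq> 0}"
      then have s: "s \<le> p" "?S (nat (p - s)) \<noteq> 0"
        by (auto split: if_splits simp: vlin_zero[OF vlin_vertex_op_left])
      then have "nat (p - s) \<le> ?D" using shifted_word_eq_0 not_le by blast
      then show "s \<in> (\<lambda>t. p - int t) ` {..?D}" using s(1) by (intro image_eqI[of _ _ "nat (p - s)"]) auto
    qed
  qed simp
  also have "\<dots> = (\<Sum>t\<le>?D. vertex_op G \<epsilon> (?S t) (l + p - int t) w)"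
    by (subst sum.reindex) (auto simp: inj_on_def algebra_simps)
  finally show ?thesis by (simp only: sum_vertex_op_shifted_word)
qed

lemma is_field_twisted_word_field: "is_field (twisted_word_field G \<epsilon> c p ws \<alpha>)"
proof (induction ws)
  case Nil
  then show ?case using is_field_shift[OF is_field_exp_field] by simp
next
  case (Cons x ws)
  obtain i k where x: "x = (i, k)" by (cases x)
  have "is_field (\<lambda>l. twisted_word_field G \<epsilon> c p ws \<alpha> (l - int (Suc k)))"
    using is_field_shift[OF Cons, of "- int (Suc k)"] by (simp only: diff_conv_add_uminus)
  then show ?case
    unfolding x twisted_word_field.simps
    by (intro is_field_add is_field_vscale is_field_nop is_field_div_deriv is_field_heis Cons)
qed

text \<open>Of all modes of alpha_i only the zero mode notices f. It belongs to the annihilation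
  half, so normal ordering lets it act first, and its shift becomes exactly the additional scalar
  term of \<open>twisted_word_field\<close>.\<close>

lemma twisted_word_field_intertwine:
  fixes f :: "'m::finite VK \<Rightarrow> 'm VK"
  assumes f: "vlin f" "\<And>v. f v = 0 \<Longrightarrow> v = 0"
    and h: "\<And>i n v. n \<noteq> 0 \<Longrightarrow> heis G (lattice_basis i) n (f v) = f (heis G (lattice_basis i) n v)"
    and h0: "\<And>i v. heis G (lattice_basis i) 0 (f v) = f (heis G (lattice_basis i) 0 v) + vscale (d i) (f v)"
    and e: "\<And>l v. f (exp_field G \<epsilon> \<alpha> (l + p) v) = exp_field G \<epsilon> \<alpha> l (f v)"
  shows "f (twisted_word_field G \<epsilon> (\<lambda>(i, k). (-1)^k * d i) p ws \<alpha> l w) = word_field G \<epsilon> ws \<alpha> l (f w)"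
proof (induction ws arbitrary: l w)
  case Nil
  then show ?case by (simp add: e)
next
  case (Cons x ws)
  obtain i k where x: "x = (i, k)" by (cases x)
  let ?a = "div_deriv k (heis G (lattice_basis i))"
  let ?T = "twisted_word_field G \<epsilon> (\<lambda>(i, k). (-1)^k * d i) p ws \<alpha>"
  have a: "is_field ?a" by (intro is_field_div_deriv is_field_heis)
  have T: "is_field ?T" by (rule is_field_twisted_word_field)
  have neg: "?a (- int j - 1) (f v) = f (?a (- int j - 1) v)" for j v
    by (simp add: div_deriv_def h vlin_vscale[OF f(1)])
  \<comment> \<open>The zero mode sits at mode k of the k-th derivative, with coefficient
    (-1)^k.\<close>
  have nonneg: "?a (int j) (f v) = f (?a (int j) v + (if j = k then vscale ((-1)^k * d i) v else 0))" for j v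
  proof (cases "j = k")
    case True
    have "(of_nat k gchoose k :: complex) = 1" by (simp add: binomial_gbinomial[symmetric])
    then show ?thesis using True by (simp add: div_deriv_def h0 vlin_vscale[OF f(1)] vlin_add[OF f(1)])
  qed (simp add: div_deriv_def h vlin_vscale[OF f(1)])
  let ?g = "\<lambda>j::nat. if j = k then vscale ((-1)^k * d i) (?T (l - int (Suc k)) w) else 0"
  have fin: "finite {j. ?g j \<noteq> 0}" by (rule finite_subset[of _ "{k}"]) auto
  have "word_field G \<epsilon> (x # ws) \<alpha> l (f w) =
      Sum_any (\<lambda>j::nat. f (?a (- int j - 1) (?T (l + int j) w))) +
      Sum_any (\<lambda>j::nat. f (?T (l - int j - 1) (?a (int j) w + (if j = k then vscale ((-1)^k * d i) w else 0))))"
    unfolding x word_field.simps nop_def nonneg neg Cons.IH[symmetric] ..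
  also have "\<dots> = f (Sum_any (\<lambda>j::nat. ?a (- int j - 1) (?T (l + int j) w)) +
      Sum_any (\<lambda>j::nat. ?T (l - int j - 1) (?a (int j) w + (if j = k then vscale ((-1)^k * d i) w else 0))))"
    by (simp only: vlin_inj_Sum_any[OF f] vlin_add[OF f(1)])
  also have "Sum_any (\<lambda>j::nat. ?T (l - int j - 1) (?a (int j) w + (if j = k then vscale ((-1)^k * d i) w else 0)))
      = Sum_any (\<lambda>j::nat. ?T (l - int j - 1) (?a (int j) w) + ?g j)"
    by (intro arg_cong[of _ _ Sum_any] ext)
      (auto simp: vlin_add[OF is_field_vlin[OF T]] vlin_vscale[OF is_field_vlin[OF T]]
        vlin_zero[OF is_field_vlin[OF T]] diff_diff_eq add.commute)
  also have "\<dots> = Sum_any (\<lambda>j::nat. ?T (l - int j - 1) (?a (int j) w)) + Sum_any ?g"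
    by (rule Sum_any.distrib[OF nop_finite_support(2)[OF a T] fin])
  also have "Sum_any ?g = vscale ((-1)^k * d i) (?T (l - int (Suc k)) w)"
    by (subst Sum_any_single[of k]) auto
  finally show ?case by (simp add: x nop_def add.assoc)
qed


section \<open>Translation by a lattice vector\<close>

lemma zform_add_right: "zform G \<alpha> (\<beta> + \<gamma>) = zform G \<alpha> \<beta> + zform G \<alpha> \<gamma>"
  by (simp add: zform_def algebra_simps sum.distrib)

lemma zform_sym:
  assumes "\<And>i j. G $ i $ j = G $ j $ i" shows "zform G \<alpha> \<beta> = zform G \<beta> \<alpha>"
  unfolding zform_def by (subst sum.swap) (simp add: assms mult.commute mult.left_commute)

lemma hform_sym:
  assumes "\<And>i j. G $ i $ j = G $ j $ i" shows "hform G u v = hform G v u"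
  unfolding hform_def by (subst sum.swap) (simp add: assms mult.commute mult.left_commute)

lemma hform_add_right: "hform G u (v + w) = hform G u v + hform G u w"
  by (simp add: hform_def algebra_simps sum.distrib)

lemma hform_lattice_embed: "hform G (lattice_embed \<alpha>) (lattice_embed \<beta>) = of_int (zform G \<alpha> \<beta>)"
  by (simp add: hform_def zform_def lattice_embed_def)

lemma lattice_embed_add: "lattice_embed (\<alpha> + \<beta>) = lattice_embed \<alpha> + lattice_embed \<beta>"
  by (simp add: lattice_embed_def vec_eq_iff)

text \<open>Right multiplication by e^gamma in the twisted group algebra. Left multiplication would
  commute with e_alpha only up to the sign (-1)^(alpha,gamma).\<close>

definition translate :: "(int^'m \<Rightarrow> int^'m \<Rightarrow> complex) \<Rightarrow> int^'m \<Rightarrow> 'm::finite VK \<Rightarrow> 'm VK" where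
  "translate \<epsilon> \<gamma> = lin_ext (\<lambda>(M, \<beta>). vscale (\<epsilon> \<beta> \<gamma>) (basis_vec (M, \<beta> + \<gamma>)))"

lemma vlin_translate: "vlin (translate \<epsilon> \<gamma>)"
  by (simp add: translate_def vlin_lin_ext)

lemma translate_basis [simp]:
  "translate \<epsilon> \<gamma> (basis_vec (M, \<beta>)) = vscale (\<epsilon> \<beta> \<gamma>) (basis_vec (M, \<beta> + \<gamma>))"
  by (simp add: translate_def)

lemma bij_translate:
  assumes "\<And>\<alpha> \<beta>. \<epsilon> \<alpha> \<beta> \<noteq> 0" shows "bij (translate \<epsilon> \<gamma>)"
proof -
  define g where "g = lin_ext (\<lambda>(M, \<beta>). vscale (1 / \<epsilon> (\<beta> - \<gamma>) \<gamma>) (basis_vec (M :: 'a monomial, \<beta> - \<gamma>)))"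
  have g: "vlin g" "g (basis_vec (M, \<beta>)) = vscale (1 / \<epsilon> (\<beta> - \<gamma>) \<gamma>) (basis_vec (M, \<beta> - \<gamma>))" for M \<beta>
    by (simp_all add: g_def vlin_lin_ext)
  have "g (translate \<epsilon> \<gamma> v) = v" for v
    by (rule vlin_eqI[where v=v], rule vlin_comp[OF g(1) vlin_translate], rule vlin_ident)
      (auto simp: g(2) vlin_vscale[OF g(1)] assms)
  moreover have "translate \<epsilon> \<gamma> (g v) = v" for v
    by (rule vlin_eqI[where v=v], rule vlin_comp[OF vlin_translate g(1)], rule vlin_ident)
      (auto simp: g(2) vlin_vscale[OF vlin_translate] assms)
  ultimately show ?thesis by (intro o_bij[of g]) (auto simp: fun_eq_iff)
qed

lemma heis_translate:
  assumes "n \<noteq> 0"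
  shows "heis G h n (translate \<epsilon> \<gamma> v) = translate \<epsilon> \<gamma> (heis G h n v)"
proof -
  have c: "creat x (translate \<epsilon> \<gamma> v) = translate \<epsilon> \<gamma> (creat x v)" for x and v :: "'a VK"
    by (rule vlin_eqI[where v=v], rule vlin_comp[OF vlin_creat vlin_translate],
        rule vlin_comp[OF vlin_translate vlin_creat])
      (auto simp: vlin_vscale[OF vlin_creat])
  have a: "annih x (translate \<epsilon> \<gamma> v) = translate \<epsilon> \<gamma> (annih x v)" for x and v :: "'a VK"
    by (rule vlin_eqI[where v=v], rule vlin_comp[OF vlin_annih vlin_translate],
        rule vlin_comp[OF vlin_translate vlin_annih])
      (auto simp: vlin_vscale[OF vlin_annih] vlin_vscale[OF vlin_translate] mult.commute)
  from assms consider "n < 0" | "n > 0" by linarith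
  then show ?thesis
    by cases (simp_all add: heis_neg heis_pos c a vlin_sum[OF vlin_translate] vlin_vscale[OF vlin_translate])
qed

lemma heis_0_translate:
  "heis G h 0 (translate \<epsilon> \<gamma> v) =
    translate \<epsilon> \<gamma> (heis G h 0 v) + vscale (hform G h (lattice_embed \<gamma>)) (translate \<epsilon> \<gamma> v)"
  by (rule vlin_eqI[where v=v], rule vlin_comp[OF vlin_heis vlin_translate],
      intro vlin_plus vlin_scaled vlin_translate vlin_comp[OF vlin_translate vlin_heis])
    (auto simp: heis_0 vlin_vscale[OF vlin_charge] vlin_vscale[OF vlin_translate]
      lattice_embed_add hform_add_right algebra_simps vscale_add_left)

text \<open>
  The scalars \<open>\<epsilon>(\<beta>,\<gamma>)\<close> in the translation make this the cocycle identity for \<open>(\<alpha>,\<beta>,\<gamma>)\<close>.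
\<close>
lemma exp_field_translate:
  assumes \<epsilon>: "lattice_cocycle G \<epsilon>" and G: "\<And>i j. G $ i $ j = G $ j $ i"
  shows "translate \<epsilon> \<gamma> (exp_field G \<epsilon> \<alpha> (l + zform G \<gamma> \<alpha>) v) = exp_field G \<epsilon> \<alpha> l (translate \<epsilon> \<gamma> v)"
proof -
  let ?f = "translate \<epsilon> \<gamma> :: 'a VK \<Rightarrow> 'a VK"
  have nz: "\<epsilon> \<alpha> \<beta> \<noteq> 0" for \<alpha> \<beta> using \<epsilon> unfolding lattice_cocycle_def by blast
  have coc: "\<epsilon> \<alpha> \<beta> * \<epsilon> (\<alpha> + \<beta>) \<gamma> = \<epsilon> \<beta> \<gamma> * \<epsilon> \<alpha> (\<beta> + \<gamma>)" for \<beta>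
    using \<epsilon> unfolding lattice_cocycle_def by blast
  have f0: "?f v = 0 \<Longrightarrow> v = 0" for v
    using bij_translate[of \<epsilon> \<gamma>, OF nz] vlin_zero[OF vlin_translate[of \<epsilon> \<gamma>]]
    by (metis bij_is_inj injD)
  define E :: "int \<Rightarrow> nat \<Rightarrow> 'a VK \<Rightarrow> 'a VK" where "E a b v = (if a < 0 then 0
       else ser_exp (\<lambda>k v. vscale (1 / of_nat k) (heis G (lattice_embed \<alpha>) (- int k) v)) (nat a)
             (ser_exp (\<lambda>k v. vscale (- 1 / of_nat k) (heis G (lattice_embed \<alpha>) (int k) v)) b v))" for a b v
  have expf: "exp_field G \<epsilon> \<alpha> n (basis_vec (M, \<beta>)) = vscale (\<epsilon> \<alpha> \<beta>)
      (Sum_any (\<lambda>b::nat. E (int b - zform G \<alpha> \<beta> - n - 1) b (basis_vec (M, \<alpha> + \<beta>))))" for n M \<beta>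
    by (simp add: exp_field_def E_def Let_def)
  have Ef: "?f (E a b v) = E a b (?f v)" for a b v
    unfolding E_def
    by (auto simp: vlin_zero[OF vlin_translate] ser_exp_commute[OF vlin_heis_series vlin_translate]
        heis_translate vlin_vscale[OF vlin_translate])
  have Es: "E a b (vscale c v) = vscale c (E a b v)" for a b c v
    by (simp add: E_def vlin_vscale[OF vlin_ser_exp[OF vlin_heis_series]])
  \<comment> \<open>Scaling by c is injective for c nonzero, so the cocycle values pass through
    \<open>Sum_any\<close> whatever the support.\<close>
  have Ss: "vscale c (Sum_any g) = Sum_any (\<lambda>b::nat. vscale c (g b))" if "c \<noteq> 0" for c and g :: "nat \<Rightarrow> 'a VK"
  proof (rule vlin_inj_Sum_any)
    show "vlin (vscale c)" by (intro vlin_scaled[OF vlin_ident])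
    fix v :: "'a VK" assume "vscale c v = 0"
    then have "vscale (1 / c) (vscale c v) = 0" by simp
    then show "v = 0" using that by simp
  qed
  show ?thesis
  proof (rule vlin_eqI[where v=v])
    show "vlin (\<lambda>v. ?f (exp_field G \<epsilon> \<alpha> (l + zform G \<gamma> \<alpha>) v))"
      by (rule vlin_comp[OF vlin_translate is_field_vlin[OF is_field_exp_field]])
    show "vlin (\<lambda>v. exp_field G \<epsilon> \<alpha> l (?f v))"
      by (rule vlin_comp[OF is_field_vlin[OF is_field_exp_field] vlin_translate])
    fix x :: "'a monomial \<times> (int^'a)"
    obtain M \<beta> where x: "x = (M, \<beta>)" by (cases x)
    \<comment> \<open>Replacing beta by beta + gamma in z^(alpha(0)) absorbs the mode shift (gamma,
      alpha).\<close>
    have exponent: "int b - zform G \<alpha> \<beta> - (l + zform G \<gamma> \<alpha>) - 1 = int b - zform G \<alpha> (\<beta> + \<gamma>) - l - 1" for b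
      by (simp add: zform_add_right zform_sym[OF G, of \<gamma>])
    have "?f (exp_field G \<epsilon> \<alpha> (l + zform G \<gamma> \<alpha>) (basis_vec x)) = vscale (\<epsilon> \<alpha> \<beta> * \<epsilon> (\<alpha> + \<beta>) \<gamma>)
        (Sum_any (\<lambda>b::nat. E (int b - zform G \<alpha> (\<beta> + \<gamma>) - l - 1) b (basis_vec (M, \<alpha> + \<beta> + \<gamma>))))"
      unfolding x expf exponent
      by (simp add: vlin_vscale[OF vlin_translate] vlin_inj_Sum_any[OF vlin_translate f0] Ef Es
          Ss[symmetric] nz)
    also have "\<dots> = exp_field G \<epsilon> \<alpha> l (?f (basis_vec x))"
      unfolding x coc
      by (simp add: vlin_vscale[OF is_field_vlin[OF is_field_exp_field]] expf add.assoc)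
    finally show "?f (exp_field G \<epsilon> \<alpha> (l + zform G \<gamma> \<alpha>) (basis_vec x)) = exp_field G \<epsilon> \<alpha> l (?f (basis_vec x))" .
  qed
qed

text \<open>Integrality places e^alpha at an integral exponent p; on a monomial,
  \<open>Delta\<close> then lives between p minus the degree and p, so the sum over s is
  finite.\<close>

lemma vlin_twisted_op:
  assumes "\<And>\<alpha>. hform G u (lattice_embed \<alpha>) \<in> \<int>"
  shows "vlin (\<lambda>v. twisted_op G (shifted_lattice_voa G \<epsilon> q) u v l w)"
proof -
  have fin: "finite {s. vertex_op G \<epsilon> (Delta G u s (basis_vec b)) (l + s) w \<noteq> 0}" for b
  proof -
    obtain ws \<alpha> where b: "b = (mset ws, \<alpha>)" using ex_mset by (metis surj_pair)
    obtain p where p: "hform G u (lattice_embed \<alpha>) = of_int p" using assms Ints_cases by metis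
    have "{s. vertex_op G \<epsilon> (Delta G u s (basis_vec b)) (l + s) w \<noteq> 0} \<subseteq> {p - int (word_degree ws)..p}"
    proof
      fix s assume "s \<in> {s. vertex_op G \<epsilon> (Delta G u s (basis_vec b)) (l + s) w \<noteq> 0}"
      then have s: "s \<le> p" "shifted_word (shift_scalar G u) ws \<alpha> (nat (p - s)) \<noteq> 0"
        by (auto split: if_splits simp: b Delta_basis[OF p] vlin_zero[OF vlin_vertex_op_left])
      then have "nat (p - s) \<le> word_degree ws" using shifted_word_eq_0 not_le by blast
      then show "s \<in> {p - int (word_degree ws)..p}" using s(1) by auto
    qed
    then show ?thesis by (rule finite_subset) simp
  qed
  show ?thesis
    unfolding twisted_op_def shifted_lattice_voa_def voa.simps
    by (rule vlin_Sum_any[OF vlin_comp[OF vlin_vertex_op_left vlin_Delta] fin])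
qed

section \<open>Comparison of the twisted and the adjoint module\<close>

lemma module_iso_translate:
  assumes \<epsilon>: "lattice_cocycle G \<epsilon>" and G: "\<And>i j. G $ i $ j = G $ j $ i"
  shows "module_iso (twisted_op G (shifted_lattice_voa G \<epsilon> q) (lattice_embed \<gamma>))
    (vop (shifted_lattice_voa G \<epsilon> q))"
proof -
  let ?f = "translate \<epsilon> \<gamma> :: 'a VK \<Rightarrow> 'a VK" and ?u = "lattice_embed \<gamma>"
  have bij: "bij ?f" using \<epsilon> unfolding lattice_cocycle_def by (intro bij_translate) blast
  have f0: "v = 0" if "?f v = 0" for v
    using injD[OF bij_is_inj[OF bij], of v 0] that by (simp add: vlin_zero[OF vlin_translate])
  have "?f (twisted_op G (shifted_lattice_voa G \<epsilon> q) ?u v l w) = vertex_op G \<epsilon> v l (?f w)" for v l w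
  proof (rule vlin_eqI[where v=v])
    show "vlin (\<lambda>v. ?f (twisted_op G (shifted_lattice_voa G \<epsilon> q) ?u v l w))"
      by (rule vlin_comp[OF vlin_translate vlin_twisted_op]) (simp add: hform_lattice_embed)
    show "vlin (\<lambda>v. vertex_op G \<epsilon> v l (?f w))" by (rule vlin_vertex_op_left)
    fix b :: "'a monomial \<times> (int^'a)"
    obtain ws \<alpha> where b: "b = (mset ws, \<alpha>)" using ex_mset by (metis surj_pair)
    have sc: "shift_scalar G ?u = (\<lambda>(i, k). (-1)^k * hform G (lattice_basis i) ?u)"
      by (simp add: shift_scalar_def hform_sym[OF G, of ?u])
    have "?f (twisted_op G (shifted_lattice_voa G \<epsilon> q) ?u (basis_vec b) l w) =
        ?f (twisted_word_field G \<epsilon> (\<lambda>(i, k). (-1)^k * hform G (lattice_basis i) ?u) (zform G \<gamma> \<alpha>) ws \<alpha> l w)"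
      unfolding b by (subst twisted_op_basis[OF hform_lattice_embed]) (simp only: sc)
    also have "\<dots> = word_field G \<epsilon> ws \<alpha> l (?f w)"
      by (rule twisted_word_field_intertwine[OF vlin_translate f0])
        (simp_all add: heis_translate heis_0_translate exp_field_translate[OF \<epsilon> G])
    finally show "?f (twisted_op G (shifted_lattice_voa G \<epsilon> q) ?u (basis_vec b) l w) =
        vertex_op G \<epsilon> (basis_vec b) l (?f w)"
      by (simp add: b vertex_op_basis)
  qed
  then show ?thesis
    unfolding module_iso_def
    by (intro exI[of _ ?f]) (simp add: bij vlin_add[OF vlin_translate] vlin_vscale[OF vlin_translate]
        shifted_lattice_voa_def)
qed

lemma lookup_charge:
  "Poly_Mapping.lookup (charge G h v) (M, \<beta>) = hform G h (lattice_embed \<beta>) * Poly_Mapping.lookup v (M, \<beta>)"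
proof (induction v rule: poly_mapping_vinduct)
  case (basis b)
  obtain N \<gamma> where b: "b = (N, \<gamma>)" by (cases b)
  show ?case unfolding b charge_basis by (simp add: basis_vec_def lookup_single when_def)
qed (simp_all add: vlin_add[OF vlin_charge] vlin_vscale[OF vlin_charge] vlin_zero[OF vlin_charge]
    lookup_add algebra_simps)

text \<open>
  An isomorphism maps the vacuum to a simultaneous eigenvector of the \<open>\<alpha>_i(0)\<close> with eigenvalues
  \<open>(u, \<alpha>_i)\<close>, and these eigenvalues must come from a lattice vector.
\<close>
lemma module_iso_imp_charge:
  assumes \<epsilon>: "lattice_cocycle G \<epsilon>" and G: "\<And>i j. G $ i $ j = G $ j $ i"
    and iso: "module_iso (twisted_op G (shifted_lattice_voa G \<epsilon> q) u) (vop (shifted_lattice_voa G \<epsilon> q))"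
  shows "\<exists>\<gamma>. \<forall>i. hform G u (lattice_basis i) = hform G (lattice_embed \<gamma>) (lattice_basis i)"
proof -
  let ?V = "shifted_lattice_voa G \<epsilon> q"
  obtain f :: "'a VK \<Rightarrow> 'a VK" where bij: "bij f" and f: "vlin f"
    and tw: "\<And>v n w. f (twisted_op G ?V u v n w) = vop ?V v n (f w)"
    using iso unfolding module_iso_def vlin_def by blast
  have "f vacuum \<noteq> 0"
    using injD[OF bij_is_inj[OF bij], of vacuum 0] vacuum_nonzero by (auto simp: vlin_zero[OF f])
  \<comment> \<open>A single component of the image serves all i at once; its lattice label is the
    vector sought.\<close>
  then obtain M \<gamma> where nz: "Poly_Mapping.lookup (f vacuum) (M, \<gamma>) \<noteq> 0"
    by (metis poly_mapping_eqI lookup_zero surj_pair)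
  have "hform G u (lattice_basis i) = hform G (lattice_embed \<gamma>) (lattice_basis i)" for i
  proof -
    \<comment> \<open>The state alpha_i(-1)1. Its component e^0 has u_0-eigenvalue 0 for every
      complex u, so p = 0; and alpha_i(0) kills the vacuum, which leaves the scalar shift (u,
      alpha_i).\<close>
    let ?v = "basis_vec (mset [(i, 0)], 0) :: 'a VK" and ?a = "heis G (lattice_basis i)"
    have "twisted_op G ?V u ?v 0 vacuum =
        twisted_word_field G \<epsilon> (shift_scalar G u) 0 [(i, 0)] 0 0 vacuum"
      by (rule twisted_op_basis) simp
    also have "\<dots> = nop ?a (exp_field G \<epsilon> 0) 0 vacuum + vscale (hform G u (lattice_basis i)) vacuum"
      by (simp add: shift_scalar_def exp_field_zero[OF \<epsilon>])
    also have "nop ?a (exp_field G \<epsilon> 0) = ?a"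
      by (rule nop_identity) (simp_all add: exp_field_zero[OF \<epsilon>])
    finally have "f (twisted_op G ?V u ?v 0 vacuum) = vscale (hform G u (lattice_basis i)) (f vacuum)"
      by (simp add: vlin_vscale[OF f])
    moreover have "vop ?V ?v 0 (f vacuum) = charge G (lattice_basis i) (f vacuum)"
      unfolding shifted_lattice_voa_def voa.simps vertex_op_basis word_field_single[OF \<epsilon>]
      by (simp add: heis_0)
    ultimately have "charge G (lattice_basis i) (f vacuum) = vscale (hform G u (lattice_basis i)) (f vacuum)"
      using tw by metis
    then have "hform G (lattice_basis i) (lattice_embed \<gamma>) = hform G u (lattice_basis i)"
      using nz lookup_charge[of G "lattice_basis i" "f vacuum" M \<gamma>] by simp
    then show ?thesis by (simp add: hform_sym[OF G, of "lattice_basis i"])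
  qed
  then show ?thesis by blast
qed

text \<open>A weight need not lie in K. But a component e^delta of its eigenvector gives (gamma,
  beta) = (gamma, delta), a pairing of two lattice vectors.\<close>

lemma lattice_embed_in_weights_dual:
  assumes "lattice_embed \<gamma> \<in> M_space G V"
  shows "lattice_embed \<gamma> \<in> weights_dual G V"
  unfolding weights_dual_def
proof (intro CollectI conjI ballI assms)
  fix \<beta> assume "\<beta> \<in> weights G V"
  then obtain a where a: "a \<noteq> 0" "heis G (lattice_embed \<gamma>) 0 a = vscale (hform G (lattice_embed \<gamma>) \<beta>) a"
    using assms by (auto simp: weights_def)
  then obtain M \<delta> where nz: "Poly_Mapping.lookup a (M, \<delta>) \<noteq> 0"
    by (metis poly_mapping_eqI lookup_zero surj_pair)
  have "hform G (lattice_embed \<gamma>) \<beta> = hform G (lattice_embed \<gamma>) (lattice_embed \<delta>)"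
    using a(2) nz lookup_charge[of G "lattice_embed \<gamma>" a M \<delta>] by (simp add: heis_0)
  then show "hform G (lattice_embed \<gamma>) \<beta> \<in> \<int>" by (simp add: hform_lattice_embed)
qed


section \<open>The root lattice of type A\<close>

lemma zspan_add: "v \<in> zspan S \<Longrightarrow> w \<in> zspan S \<Longrightarrow> v + w \<in> zspan S"
proof -
  assume "v \<in> zspan S" "w \<in> zspan S"
  then obtain c d where "v = (\<Sum>x\<in>S. real_of_int (c x) *\<^sub>R x)" "w = (\<Sum>x\<in>S. real_of_int (d x) *\<^sub>R x)"
    by (auto simp: zspan_def)
  then have "v + w = (\<Sum>x\<in>S. real_of_int (c x + d x) *\<^sub>R x)"
    by (simp add: scaleR_add_left sum.distrib)
  then show ?thesis unfolding zspan_def by (intro CollectI exI[of _ "\<lambda>x. c x + d x"]) simp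
qed

lemma zspan_zero: "0 \<in> zspan S"
  unfolding zspan_def by (intro CollectI exI[of _ "\<lambda>_. 0"]) simp

lemma zspan_sum: "(\<And>i. i \<in> I \<Longrightarrow> f i \<in> zspan S) \<Longrightarrow> sum f I \<in> zspan S"
  by (induction I rule: infinite_finite_induct) (auto intro: zspan_add zspan_zero)

lemma zspan_base:
  assumes "finite S" "v \<in> S" shows "real_of_int n *\<^sub>R v \<in> zspan S"
proof -
  have "(\<Sum>x\<in>S. real_of_int (if x = v then n else 0) *\<^sub>R x) = (\<Sum>x\<in>S. if x = v then real_of_int n *\<^sub>R x else 0)"
    by (intro sum.cong) auto
  also have "\<dots> = real_of_int n *\<^sub>R v" using assms by simp
  finally show ?thesis unfolding zspan_def by (intro CollectI exI[of _ "\<lambda>x. if x = v then n else 0"]) simp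
qed

lemma finite_A_roots: "finite (A_roots :: (real^'m) set)"
proof (rule finite_subset)
  show "A_roots \<subseteq> range (\<lambda>(i, j). axis i 1 - axis j 1 :: real^'m)" by (auto simp: A_roots_def)
qed simp

lemma sum_axis: "(\<Sum>i\<in>UNIV. axis j c $ i) = (c :: 'a::comm_monoid_add)"
  by (simp add: axis_def)

text \<open>With coordinate sum zero, x is the sum of the x_i (e_i - e_i0) for any fixed index i0:
  the total correction at i0 cancels.\<close>

lemma A_root_lattice_eq:
  "(A_root_lattice :: (real^'m) set) = {x. (\<forall>i. x $ i \<in> \<int>) \<and> (\<Sum>i\<in>UNIV. x $ i) = 0}"
proof (intro Set.equalityI subsetI CollectI)
  fix x :: "real^'m" assume "x \<in> A_root_lattice"
  then obtain c where x: "x = (\<Sum>v\<in>A_roots. real_of_int (c v) *\<^sub>R v)"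
    by (auto simp: A_root_lattice_def zspan_def)
  have r: "v $ i \<in> \<int>" "(\<Sum>i\<in>UNIV. v $ i) = 0" if "v \<in> A_roots" for v :: "real^'m" and i
    using that by (auto simp: A_roots_def axis_def sum_subtractf)
  have "(\<Sum>i\<in>UNIV. x $ i) = (\<Sum>v\<in>A_roots. real_of_int (c v) * (\<Sum>i\<in>UNIV. v $ i))"
    unfolding x by (simp add: sum_distrib_left) (rule sum.swap)
  then show "(\<forall>i. x $ i \<in> \<int>) \<and> (\<Sum>i\<in>UNIV. x $ i) = 0"
    by (auto simp: r x intro!: Ints_sum Ints_mult)
next
  fix x :: "real^'m" assume "x \<in> {x. (\<forall>i. x $ i \<in> \<int>) \<and> (\<Sum>i\<in>UNIV. x $ i) = 0}"
  then have x: "\<And>i. x $ i \<in> \<int>" "(\<Sum>i\<in>UNIV. x $ i) = 0" by auto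
  define i0 :: 'm where "i0 = undefined"
  have "(\<Sum>i\<in>UNIV. (x $ i) *\<^sub>R (axis i 1 - axis i0 1)) $ j = x $ j" for j
  proof -
    have "(\<Sum>i\<in>UNIV. (x $ i) *\<^sub>R (axis i 1 - axis i0 1)) $ j =
        (\<Sum>i\<in>UNIV. if i = j then x $ i else 0) - (\<Sum>i\<in>UNIV. x $ i) * (axis i0 1 $ j)"
      unfolding sum_component sum_distrib_right sum_subtractf[symmetric]
      by (intro sum.cong) (auto simp: axis_def)
    then show ?thesis by (simp add: x(2))
  qed
  then have "x = (\<Sum>i\<in>UNIV. (x $ i) *\<^sub>R (axis i 1 - axis i0 1))" by (intro vec_eq_iff[THEN iffD2] allI) (rule sym)
  also have "\<dots> \<in> zspan A_roots"
  proof (rule zspan_sum)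
    fix i
    obtain n where n: "x $ i = real_of_int n" using x(1) Ints_cases by metis
    show "(x $ i) *\<^sub>R (axis i 1 - axis i0 1) \<in> zspan A_roots"
    \<comment> \<open>The difference at i = i0 is the zero vector, which is not a root.\<close>
    proof (cases "i = i0")
      case False
      then show ?thesis unfolding n by (intro zspan_base finite_A_roots) (auto simp: A_roots_def)
    qed (simp add: zspan_zero)
  qed
  finally show "x \<in> A_root_lattice" by (simp add: A_root_lattice_def)
qed

section \<open>The root lattice of A_1^m: kernel, isometry type, minimal norm\<close>

theorem theorem5p17:
  fixes G :: "int^'m^'m"
    and \<epsilon> :: "int^'m \<Rightarrow> int^'m \<Rightarrow> complex"
    and \<rho> q :: "complex^'m"
    and V :: "'m voa"
    and K R \<K> :: "(complex^'m) set"
  assumes "CARD('m) \<ge> 2"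
    and "\<And>i j. G $ i $ j = (if i = j then 2 else 0)"
    and "lattice_cocycle G \<epsilon>"
    and "K = range lattice_embed"
    and "\<rho> = (\<Sum>i\<in>UNIV. lattice_basis i)"
    and "q = (1/2) *s \<rho>"
    and "V = shifted_lattice_voa G \<epsilon> q"
    and "\<K> = {u \<in> weights_dual G V. module_iso (twisted_op G V u) (vop V)}"
    and "R = {\<Sum>i\<in>UNIV. of_int (n i) *s lattice_basis i |n. (\<Sum>i\<in>UNIV. n i) = (0::int)}"
  shows "\<K> = K \<inter> {u. hform G u \<rho> = 0} \<and>
    K \<inter> {u. hform G u \<rho> = 0} = R \<and>
    lattice_isometric \<K> (hform G)
      (A_root_lattice :: (real^'m) set) (\<lambda>x y. of_real (2 * (x \<bullet> y))) \<and>
    is_min_norm (hform G) \<K> 4"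
proof -
  have G: "G $ i $ j = G $ j $ i" for i j by (simp add: assms(2))
  have form: "hform G u v = 2 * (\<Sum>i\<in>UNIV. u $ i * v $ i)" for u v
  proof -
    have "hform G u v = (\<Sum>i\<in>UNIV. \<Sum>j\<in>UNIV. if j = i then 2 * (u $ i * v $ j) else 0)"
      unfolding hform_def by (intro sum.cong) (auto simp: assms(2))
    then show ?thesis by (simp add: sum_distrib_left)
  qed
  have \<rho>: "\<rho> $ i = 1" for i by (simp add: assms(5) lattice_basis_def axis_def)
  have M: "M_space G V = {u. hform G u \<rho> = 0}"
    unfolding assms(7) M_space_shifted_lattice_voa[OF assms(3) G]
    by (simp add: form assms(6) \<rho> sum_divide_distrib[symmetric])
  have \<K>: "\<K> = K \<inter> {u. hform G u \<rho> = 0}"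
  proof (intro Set.equalityI subsetI)
    fix u assume "u \<in> \<K>"
    then have u: "u \<in> weights_dual G V" "module_iso (twisted_op G V u) (vop V)" by (auto simp: assms(8))
    from u(2) obtain \<gamma> where
      \<gamma>: "\<And>i. hform G u (lattice_basis i) = hform G (lattice_embed \<gamma>) (lattice_basis i)"
      unfolding assms(7) using module_iso_imp_charge[OF assms(3) G] by metis
    \<comment> \<open>The alpha_i are orthogonal of norm 2, so pairing with alpha_i gives twice the
      i-th coordinate and the pairings determine u.\<close>
    have "u $ i = lattice_embed \<gamma> $ i" for i
      using \<gamma>[of i] by (simp add: form lattice_basis_def axis_def if_distrib[of "(*) _"] cong: if_cong)
    then have "u = lattice_embed \<gamma>" by (simp add: vec_eq_iff)
    then show "u \<in> K \<inter> {u. hform G u \<rho> = 0}"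
      using u(1) M by (auto simp: assms(4) weights_dual_def)
  next
    fix u assume "u \<in> K \<inter> {u. hform G u \<rho> = 0}"
    then obtain \<gamma> where u: "u = lattice_embed \<gamma>" and "u \<in> M_space G V" by (auto simp: assms(4) M)
    then have "u \<in> weights_dual G V" using lattice_embed_in_weights_dual by blast
    then show "u \<in> \<K>" using module_iso_translate[OF assms(3) G] by (simp add: assms(7,8) u)
  qed
  have KR: "u \<in> \<K> \<longleftrightarrow> (\<exists>n. u = lattice_embed n \<and> (\<Sum>i\<in>UNIV. n $ i) = 0)" for u
  proof -
    have "hform G (lattice_embed n) \<rho> = 0 \<longleftrightarrow> (\<Sum>i\<in>UNIV. n $ i) = 0" for n
      by (simp add: form \<rho> lattice_embed_def of_int_sum[symmetric] del: of_int_sum)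
    then show ?thesis by (auto simp: \<K> assms(4))
  qed
  have lincomb: "(\<Sum>i\<in>UNIV. of_int (n i) *s lattice_basis i) = (lattice_embed (\<chi> i. n i) :: complex^'m)" for n
    by (simp add: vec_eq_iff lattice_embed_def lattice_basis_def axis_def if_distrib[of "(*) _"] cong: if_cong)
  have R: "R = \<K>"
  proof (intro Set.equalityI subsetI)
    fix u assume "u \<in> R"
    then obtain n where "u = lattice_embed (\<chi> i. n i)" "(\<Sum>i\<in>UNIV. n i) = 0"
      unfolding assms(9) lincomb by blast
    then show "u \<in> \<K>" unfolding KR by (intro exI[of _ "\<chi> i. n i"]) simp
  next
    fix u assume "u \<in> \<K>"
    then obtain n where "u = lattice_embed n" "(\<Sum>i\<in>UNIV. n $ i) = 0" unfolding KR by blast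
    then show "u \<in> R" unfolding assms(9) lincomb by (intro CollectI exI[of _ "\<lambda>i. n $ i"]) simp
  qed
  have isometric: "lattice_isometric \<K> (hform G)
      (A_root_lattice :: (real^'m) set) (\<lambda>x y. of_real (2 * (x \<bullet> y)))"
    unfolding lattice_isometric_def
  \<comment> \<open>The map sends alpha_i to the i-th unit vector. Coordinates are integers on the
    kernel, so real parts lose nothing, and the factor 2 accounts for (alpha_i, alpha_i) =
    2.\<close>
  proof (intro exI[of _ "\<lambda>u. \<chi> i. Re (u $ i)"] conjI ballI)
    let ?\<phi> = "\<lambda>u::complex^'m. \<chi> i. Re (u $ i)"
    show "bij_betw ?\<phi> \<K> A_root_lattice"
      unfolding bij_betw_def
    proof
      show "inj_on ?\<phi> \<K>" by (auto simp: inj_on_def KR vec_eq_iff lattice_embed_def)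
      show "?\<phi> ` \<K> = A_root_lattice"
      proof (intro Set.equalityI subsetI)
        fix x assume "x \<in> ?\<phi> ` \<K>"
        then show "x \<in> A_root_lattice"
          by (auto simp: KR A_root_lattice_eq lattice_embed_def of_int_sum[symmetric] simp del: of_int_sum)
      next
        fix x :: "real^'m" assume "x \<in> A_root_lattice"
        then have x: "\<And>i. x $ i \<in> \<int>" "(\<Sum>i\<in>UNIV. x $ i) = 0" by (auto simp: A_root_lattice_eq)
        have fl: "of_int \<lfloor>x $ i\<rfloor> = x $ i" for i using x(1) by simp
        define n :: "int^'m" where "n = (\<chi> i. \<lfloor>x $ i\<rfloor>)"
        have "real_of_int (\<Sum>i\<in>UNIV. n $ i) = 0" by (simp add: n_def fl x(2))
        then have "lattice_embed n \<in> \<K>" unfolding KR of_int_eq_0_iff by blast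
        moreover have "x = ?\<phi> (lattice_embed n)"
          by (simp add: n_def lattice_embed_def fl vec_eq_iff)
        ultimately show "x \<in> ?\<phi> ` \<K>" by blast
      qed
    qed
  next
    fix u v assume "u \<in> \<K>" "v \<in> \<K>"
    then show "complex_of_real (2 * ((\<chi> i. Re (u $ i)) \<bullet> (\<chi> i. Re (v $ i)))) = hform G u v"
      by (auto simp: KR form lattice_embed_def inner_vec_def)
  qed (simp add: vec_eq_iff)
  have norm: "hform G (lattice_embed n) (lattice_embed n) = of_real (real_of_int (2 * (\<Sum>i\<in>UNIV. (n $ i)\<^sup>2)))" for n
    by (simp add: form lattice_embed_def power2_eq_square)
  have "is_min_norm (hform G) \<K> 4"
    unfolding is_min_norm_def
  proof (intro conjI ballI impI)
    obtain i j :: 'm where ij: "i \<noteq> j"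
      using assms(1) card_le_Suc0_iff_eq[of "UNIV :: 'm set"] by fastforce
    \<comment> \<open>The witness alpha_i - alpha_j of norm 2 + 2; two distinct indices exist
      because m >= 2.\<close>
    define n :: "int^'m" where "n = axis i 1 - axis j 1"
    have "(\<Sum>k\<in>UNIV. n $ k) = 0" by (simp add: n_def sum_subtractf sum_axis)
    then have "lattice_embed n \<in> \<K>" using KR by blast
    moreover have "n $ i = 1" using ij by (simp add: n_def axis_def)
    then have "lattice_embed n \<noteq> 0" by (auto simp: lattice_embed_def vec_eq_iff intro!: exI[of _ i])
    moreover have "(\<Sum>k\<in>UNIV. (n $ k)\<^sup>2) = (\<Sum>k\<in>UNIV. (axis i 1 $ k) + (axis j 1 $ k))"
      using ij by (intro sum.cong) (auto simp: n_def axis_def)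
    then have "(\<Sum>k\<in>UNIV. (n $ k)\<^sup>2) = 2" by (simp add: sum.distrib sum_axis)
    ultimately show "\<exists>v\<in>\<K>. v \<noteq> 0 \<and> hform G v v = of_real 4"
      by (intro bexI[of _ "lattice_embed n"] conjI) (simp_all add: norm)
  next
    fix v assume "v \<in> \<K>" "v \<noteq> 0"
    then obtain n where n: "v = lattice_embed n" "(\<Sum>i\<in>UNIV. n $ i) = 0" and "n \<noteq> 0"
      using KR by fastforce
    then obtain i where i: "n $ i \<noteq> 0" by (auto simp: vec_eq_iff)
    \<comment> \<open>A single nonzero coordinate cannot sum to zero. Two nonzero integer
      coordinates contribute at least 1 each to the sum of squares, and the form doubles it.\<close>
    have "\<exists>j. j \<noteq> i \<and> n $ j \<noteq> 0"
    proof (rule ccontr)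
      assume "\<not> ?thesis"
      then have "(\<Sum>j\<in>UNIV. n $ j) = (\<Sum>j\<in>UNIV. if j = i then n $ i else 0)"
        by (intro sum.cong) auto
      then show False using n(2) i by simp
    qed
    then obtain j where j: "j \<noteq> i" "n $ j \<noteq> 0" by blast
    have "(n $ i)\<^sup>2 \<ge> 1" "(n $ j)\<^sup>2 \<ge> 1"
      using i j(2) zero_less_power2[of "n $ i"] zero_less_power2[of "n $ j"] by linarith+
    moreover have "(\<Sum>k\<in>{i, j}. (n $ k)\<^sup>2) \<le> (\<Sum>k\<in>UNIV. (n $ k)\<^sup>2)"
      by (intro sum_mono2) auto
    ultimately have "2 * (\<Sum>k\<in>UNIV. (n $ k)\<^sup>2) \<ge> 4" using j(1) by simp
    then have "real_of_int (2 * (\<Sum>k\<in>UNIV. (n $ k)\<^sup>2)) \<ge> 4" by linarith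
    then show "\<exists>r\<ge>4. hform G v v = of_real r" using norm n(1) by blast
  qed
  then show ?thesis using \<K> R isometric by blast
qed

end
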